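(* Let $G$ be an infinite, finitely generated, torsion-free, nilpotent group and let $a\in[1,\infty)$. Then there exists a regular Toeplitz array $x\in\{0,1\}^G$ whose Toeplitz subshift $(\overline{O_G(x)},G)$ has amorphic complexity $a$, i.e. for every Følner sequence $\mathcal{F}$ in $G$ the amorphic complexity $\mathrm{ac}_{\mathcal{F}}(\overline{O_G(x)},G)$ exists and equals $a$.
   Context: $G$ acts on $\{0,1\}^G$ (product topology) by the shift $(gx)(h)=x(hg)$; $O_G(x)=\{gx:g\in G\}$. Elements of $\{0,1\}^G$ are called arrays; a compact shift-invariant subset of $\{0,1\}^G$ is a subshift. Toeplitz arrays: for $x\in\{0,1\}^G$, a subgroup $\Gamma\le G$ and $\alpha\in\{0,1\}$ let $\mathrm{Per}(x,\Gamma,\alpha)=\{g\in G: x(g\gamma)=\alpha\ \forall\gamma\in\Gamma\}$ and $\mathrm{Per}(x,\Gamma)=\mathrm{Per}(x,\Gamma,0)\cup\mathrm{Per}(x,\Gamma,1)$. $x$ is a Toeplitz array if every $g\in G$ lies in $\mathrm{Per}(x,\Gamma)$ for some finite index subgroup $\Gamma$; its orbit closure $\overline{O_G(x)}$ is then a Toeplitz subshift. For a finite index subgroup $\Gamma$ let $D(x,\Gamma)=\#(D\cap\mathrm{Per}(x,\Gamma))/\#D$, where $D\subseteq G$ is any fundamental domain of $G/\Gamma$ (a set mapped bijectively onto $G/\Gamma$ by $g\mapsto g\Gamma$). A Toeplitz array $x$ is regular if $\sup\{D(x,\Gamma):\Gamma\text{ a finite index subgroup of }G\}=1$. Amorphic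 complexity: a Følner sequence in $G$ is a sequence $\mathcal{F}=(F_n)_{n\in\mathbb{N}}$ of nonempty finite subsets of $G$ with $\#(gF_n\triangle F_n)/\#F_n\to0$ for every $g\in G$. Put $D_{\mathcal{F}}(x,y)=\limsup_{n\to\infty}\frac{1}{\#F_n}\#\{g\in F_n:x(g)\ne y(g)\}$, a pseudometric on $\{0,1\}^G$. For a subshift $X$, $[X]_{\mathcal{F}}$ is the image of $X$ in the quotient of $\{0,1\}^G$ by the relation $D_{\mathcal{F}}(x,y)=0$, a metric space with metric $D_{\mathcal{F}}$. For a metric space $(Z,d)$, let $\mathrm{Sep}(Z,d,\varepsilon)$ be the (possibly infinite) maximal cardinality of a subset whose distinct points have distance $\ge\varepsilon$; the upper (lower) box dimension of $(Z,d)$ is the $\limsup$ ($\liminf$) as $\varepsilon\to0$ of $\log\mathrm{Sep}(Z,d,\varepsilon)/(-\log\varepsilon)$. The upper (lower) amorphic complexity $\overline{\mathrm{ac}}_{\mathcal{F}}(X,G)$ ($\underline{\mathrm{ac}}_{\mathcal{F}}(X,G)$) is the upper (lower) box dimension of $([X]_{\mathcal{F}},D_{\mathcal{F}})$, and $\mathrm{ac}_{\mathcal{F}}(X,G)$ is their common value when they coincide. *)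

theory Defs
  imports
    "HOL-Analysis.Analysis"
    "HOL-Algebra.Generated_Groups"
    "HOL-Algebra.Left_Coset"
begin

section \<open>Classes of groups\<close>

definition finitely_generated_group :: "('a, 'b) monoid_scheme \<Rightarrow> bool" where
  "finitely_generated_group G \<longleftrightarrow>
     (\<exists>S. finite S \<and> S \<subseteq> carrier G \<and> generate G S = carrier G)"

definition torsion_free_group :: "('a, 'b) monoid_scheme \<Rightarrow> bool" where
  "torsion_free_group G \<longleftrightarrow>
     (\<forall>g\<in>carrier G. g \<noteq> \<one>\<^bsub>G\<^esub> \<longrightarrow> (\<forall>n::nat. n > 0 \<longrightarrow> g [^]\<^bsub>G\<^esub> n \<noteq> \<one>\<^bsub>G\<^esub>))"

primrec lower_central_series :: "('a, 'b) monoid_scheme \<Rightarrow> nat \<Rightarrow> 'a set" where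
  "lower_central_series G 0 = carrier G"
| "lower_central_series G (Suc n) =
     generate G (\<Union>h\<in>lower_central_series G n. \<Union>g\<in>carrier G.
       {h \<otimes>\<^bsub>G\<^esub> g \<otimes>\<^bsub>G\<^esub> inv\<^bsub>G\<^esub> h \<otimes>\<^bsub>G\<^esub> inv\<^bsub>G\<^esub> g})"

definition nilpotent_group :: "('a, 'b) monoid_scheme \<Rightarrow> bool" where
  "nilpotent_group G \<longleftrightarrow> (\<exists>n. lower_central_series G n = {\<one>\<^bsub>G\<^esub>})"


section \<open>Arrays and the shift\<close>

text \<open>
  The symbols 0 and 1 are represented by False and True.  Arrays are functions on the carrier,
  made total by the value \<open>undefined\<close> outside it, so that equality of arrays is
  equality on the group.
\<close>

definition array_topology :: "('a, 'b) monoid_scheme \<Rightarrow> ('a \<Rightarrow> bool) topology" where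
  "array_topology G = product_topology (\<lambda>_. discrete_topology UNIV) (carrier G)"

definition arrays :: "('a, 'b) monoid_scheme \<Rightarrow> ('a \<Rightarrow> bool) set" where
  "arrays G = (carrier G \<rightarrow>\<^sub>E UNIV)"

lemma topspace_array_topology: "topspace (array_topology G) = arrays G"
  by (simp add: array_topology_def arrays_def)

definition shift :: "('a, 'b) monoid_scheme \<Rightarrow> 'a \<Rightarrow> ('a \<Rightarrow> bool) \<Rightarrow> ('a \<Rightarrow> bool)" where
  "shift G g x = (\<lambda>h\<in>carrier G. x (h \<otimes>\<^bsub>G\<^esub> g))"

definition shift_orbit :: "('a, 'b) monoid_scheme \<Rightarrow> ('a \<Rightarrow> bool) \<Rightarrow> ('a \<Rightarrow> bool) set" where
  "shift_orbit G x = (\<lambda>g. shift G g x) ` carrier G"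

definition orbit_closure :: "('a, 'b) monoid_scheme \<Rightarrow> ('a \<Rightarrow> bool) \<Rightarrow> ('a \<Rightarrow> bool) set" where
  "orbit_closure G x = Abstract_Topology.closure_of (array_topology G) (shift_orbit G x)"


section \<open>Toeplitz arrays\<close>

definition finite_index_subgroup :: "('a, 'b) monoid_scheme \<Rightarrow> 'a set \<Rightarrow> bool" where
  "finite_index_subgroup G \<Gamma> \<longleftrightarrow> subgroup \<Gamma> G \<and> finite (lcosets\<^bsub>G\<^esub> \<Gamma>)"

definition Per_symbol :: "('a, 'b) monoid_scheme \<Rightarrow> ('a \<Rightarrow> bool) \<Rightarrow> 'a set \<Rightarrow> bool \<Rightarrow> 'a set" where
  "Per_symbol G x \<Gamma> \<alpha> = {g \<in> carrier G. \<forall>\<gamma>\<in>\<Gamma>. x (g \<otimes>\<^bsub>G\<^esub> \<gamma>) = \<alpha>}"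

definition Per :: "('a, 'b) monoid_scheme \<Rightarrow> ('a \<Rightarrow> bool) \<Rightarrow> 'a set \<Rightarrow> 'a set" where
  "Per G x \<Gamma> = Per_symbol G x \<Gamma> False \<union> Per_symbol G x \<Gamma> True"

definition toeplitz_array :: "('a, 'b) monoid_scheme \<Rightarrow> ('a \<Rightarrow> bool) \<Rightarrow> bool" where
  "toeplitz_array G x \<longleftrightarrow> x \<in> arrays G \<and>
     (\<forall>g\<in>carrier G. \<exists>\<Gamma>. finite_index_subgroup G \<Gamma> \<and> g \<in> Per G x \<Gamma>)"

definition fundamental_domain :: "('a, 'b) monoid_scheme \<Rightarrow> 'a set \<Rightarrow> 'a set \<Rightarrow> bool" where
  "fundamental_domain G \<Gamma> D \<longleftrightarrow>
     D \<subseteq> carrier G \<and> bij_betw (\<lambda>g. g <#\<^bsub>G\<^esub> \<Gamma>) D (lcosets\<^bsub>G\<^esub> \<Gamma>)"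

definition periodic_density :: "('a, 'b) monoid_scheme \<Rightarrow> ('a \<Rightarrow> bool) \<Rightarrow> 'a set \<Rightarrow> real" where
  "periodic_density G x \<Gamma> =
     (let D = SOME D. fundamental_domain G \<Gamma> D in real (card (D \<inter> Per G x \<Gamma>)) / real (card D))"

lemma Per_coset:
  assumes "group G" "subgroup \<Gamma> G" "g \<in> Per G x \<Gamma>"
  shows "g <#\<^bsub>G\<^esub> \<Gamma> \<subseteq> Per G x \<Gamma>"
proof -
  interpret group G by fact
  interpret subgroup \<Gamma> G by fact
  from assms(3) show ?thesis
    unfolding Per_def Per_symbol_def l_coset_def by (auto simp: m_assoc)
qed

lemma fundamental_domain_card_Per:
  assumes "group G" "subgroup \<Gamma> G" "fundamental_domain G \<Gamma> D"
  shows "card (D \<inter> Per G x \<Gamma>) = card {C \<in> lcosets\<^bsub>G\<^esub> \<Gamma>. C \<subseteq> Per G x \<Gamma>}"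
proof -
  let ?q = "\<lambda>g. g <#\<^bsub>G\<^esub> \<Gamma>"
  have D: "D \<subseteq> carrier G" "inj_on ?q D" "?q ` D = lcosets\<^bsub>G\<^esub> \<Gamma>"
    using assms(3) by (auto simp: fundamental_domain_def bij_betw_def)
  have "?q ` (D \<inter> Per G x \<Gamma>) = {C \<in> lcosets\<^bsub>G\<^esub> \<Gamma>. C \<subseteq> Per G x \<Gamma>}"
  proof (intro equalityI subsetI)
    fix C assume "C \<in> ?q ` (D \<inter> Per G x \<Gamma>)"
    then show "C \<in> {C \<in> lcosets\<^bsub>G\<^esub> \<Gamma>. C \<subseteq> Per G x \<Gamma>}"
      using D(3) Per_coset[OF assms(1,2)] by fastforce
  next
    fix C assume C: "C \<in> {C \<in> lcosets\<^bsub>G\<^esub> \<Gamma>. C \<subseteq> Per G x \<Gamma>}"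
    then obtain g where g: "g \<in> D" "C = ?q g"
      using D(3) by blast
    moreover have "g \<in> ?q g"
      using g(1) D(1) group.lcos_self[OF assms(1) _ assms(2)] by blast
    ultimately show "C \<in> ?q ` (D \<inter> Per G x \<Gamma>)"
      using C by blast
  qed
  then show ?thesis
    using card_image[of ?q "D \<inter> Per G x \<Gamma>"] D(2) by (metis inf_le1 inj_on_subset)
qed

text \<open>The choice made in the definition of the density is immaterial.\<close>

lemma periodic_density_eq:
  assumes "group G" "subgroup \<Gamma> G" "fundamental_domain G \<Gamma> D"
  shows "periodic_density G x \<Gamma> = real (card (D \<inter> Per G x \<Gamma>)) / real (card D)"
proof -
  define E where "E = (SOME D. fundamental_domain G \<Gamma> D)"
  have E: "fundamental_domain G \<Gamma> E"
    unfolding E_def by (rule someI[of _ D]) (rule assms(3))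
  have "card D = card (lcosets\<^bsub>G\<^esub> \<Gamma>)" "card E = card (lcosets\<^bsub>G\<^esub> \<Gamma>)"
    using assms(3) E by (auto simp: fundamental_domain_def intro: bij_betw_same_card)
  then show ?thesis
    by (simp add: periodic_density_def Let_def flip: E_def)
       (simp add: fundamental_domain_card_Per[OF assms(1,2)] E assms(3))
qed

lemma fundamental_domain_exists: "\<exists>D. fundamental_domain G \<Gamma> D"
proof -
  have "lcosets\<^bsub>G\<^esub> \<Gamma> = (\<lambda>g. g <#\<^bsub>G\<^esub> \<Gamma>) ` carrier G"
    by (auto simp: LCOSETS_def)
  then show ?thesis
    unfolding fundamental_domain_def
    by (metis inj_on_imp_bij_betw subset_image_inj order_refl)
qed

definition regular_toeplitz_array :: "('a, 'b) monoid_scheme \<Rightarrow> ('a \<Rightarrow> bool) \<Rightarrow> bool" where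
  "regular_toeplitz_array G x \<longleftrightarrow> toeplitz_array G x \<and>
     (SUP \<Gamma>\<in>{\<Gamma>. finite_index_subgroup G \<Gamma>}. periodic_density G x \<Gamma>) = 1"


section \<open>Box dimension\<close>

text \<open>
  Only the values of \<open>d\<close> on \<open>Z\<close> matter in this section.  For nonempty
  \<open>Z\<close> the separation number is at least 1, so the value of \<open>ln 0\<close> plays no role.
\<close>

definition separation_number :: "'z set \<Rightarrow> ('z \<Rightarrow> 'z \<Rightarrow> real) \<Rightarrow> real \<Rightarrow> enat" where
  "separation_number Z d \<epsilon> =
     (SUP S\<in>{S. S \<subseteq> Z \<and> pairwise (\<lambda>p q. \<epsilon> \<le> d p q) S}. if finite S then enat (card S) else \<infinity>)"

definition log_enat :: "enat \<Rightarrow> ereal" where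
  "log_enat k = (case k of enat n \<Rightarrow> ereal (ln (real n)) | \<infinity> \<Rightarrow> \<infinity>)"

definition upper_box_dimension :: "'z set \<Rightarrow> ('z \<Rightarrow> 'z \<Rightarrow> real) \<Rightarrow> ereal" where
  "upper_box_dimension Z d =
     Limsup (at_right 0) (\<lambda>\<epsilon>. log_enat (separation_number Z d \<epsilon>) / ereal (- ln \<epsilon>))"

definition lower_box_dimension :: "'z set \<Rightarrow> ('z \<Rightarrow> 'z \<Rightarrow> real) \<Rightarrow> ereal" where
  "lower_box_dimension Z d =
     Liminf (at_right 0) (\<lambda>\<epsilon>. log_enat (separation_number Z d \<epsilon>) / ereal (- ln \<epsilon>))"


section \<open>Amorphic complexity\<close>

definition folner_sequence :: "('a, 'b) monoid_scheme \<Rightarrow> (nat \<Rightarrow> 'a set) \<Rightarrow> bool" where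
  "folner_sequence G F \<longleftrightarrow>
     (\<forall>n. finite (F n) \<and> F n \<noteq> {} \<and> F n \<subseteq> carrier G) \<and>
     (\<forall>g\<in>carrier G.
        (\<lambda>n. real (card (sym_diff (g <#\<^bsub>G\<^esub> F n) (F n))) / real (card (F n))) \<longlonglongrightarrow> 0)"

definition besicovitch_dist ::
    "(nat \<Rightarrow> 'a set) \<Rightarrow> ('a \<Rightarrow> bool) \<Rightarrow> ('a \<Rightarrow> bool) \<Rightarrow> real" where
  "besicovitch_dist F x y =
     real_of_ereal (limsup (\<lambda>n. ereal (real (card {g \<in> F n. x g \<noteq> y g}) / real (card (F n)))))"

definition besicovitch_rel ::
    "('a, 'b) monoid_scheme \<Rightarrow> (nat \<Rightarrow> 'a set) \<Rightarrow> (('a \<Rightarrow> bool) \<times> ('a \<Rightarrow> bool)) set" where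
  "besicovitch_rel G F = {(x, y). x \<in> arrays G \<and> y \<in> arrays G \<and> besicovitch_dist F x y = 0}"

text \<open>
  The quotient \<open>X // besicovitch_rel G F\<close> consists of the full equivalence classes
  (in the space of all arrays) of the elements of \<open>X\<close>, that is, it is the image of
  \<open>X\<close> in the quotient of the space of all arrays.
\<close>

definition besicovitch_image ::
    "('a, 'b) monoid_scheme \<Rightarrow> (nat \<Rightarrow> 'a set) \<Rightarrow> ('a \<Rightarrow> bool) set \<Rightarrow> ('a \<Rightarrow> bool) set set" where
  "besicovitch_image G F X = X // besicovitch_rel G F"

definition class_dist ::
    "(nat \<Rightarrow> 'a set) \<Rightarrow> ('a \<Rightarrow> bool) set \<Rightarrow> ('a \<Rightarrow> bool) set \<Rightarrow> real" where
  "class_dist F A B = the_elem (\<Union>x\<in>A. \<Union>y\<in>B. {besicovitch_dist F x y})"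

definition upper_amorphic_complexity ::
    "(nat \<Rightarrow> 'a set) \<Rightarrow> ('a \<Rightarrow> bool) set \<Rightarrow> ('a, 'b) monoid_scheme \<Rightarrow> ereal" where
  "upper_amorphic_complexity F X G = upper_box_dimension (besicovitch_image G F X) (class_dist F)"

definition lower_amorphic_complexity ::
    "(nat \<Rightarrow> 'a set) \<Rightarrow> ('a \<Rightarrow> bool) set \<Rightarrow> ('a, 'b) monoid_scheme \<Rightarrow> ereal" where
  "lower_amorphic_complexity F X G = lower_box_dimension (besicovitch_image G F X) (class_dist F)"

definition has_amorphic_complexity ::
    "(nat \<Rightarrow> 'a set) \<Rightarrow> ('a \<Rightarrow> bool) set \<Rightarrow> ('a, 'b) monoid_scheme \<Rightarrow> ereal \<Rightarrow> bool" where
  "has_amorphic_complexity F X G c \<longleftrightarrow>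
     upper_amorphic_complexity F X G = c \<and> lower_amorphic_complexity F X G = c"

subsection \<open>The distance of classes is well defined\<close>

lemma besicovitch_limsup:
  "ereal (besicovitch_dist F x y) =
     limsup (\<lambda>n. ereal (real (card {g \<in> F n. x g \<noteq> y g}) / real (card (F n))))"
  (is "_ = limsup ?u") if "\<And>n. finite (F n)"
proof -
  have "limsup ?u \<le> limsup (\<lambda>n. 1)"
    by (rule Limsup_mono, rule always_eventually)
       (auto simp: that divide_le_eq_1 intro!: card_mono card_gt_0_iff[THEN iffD2])
  moreover have "liminf (\<lambda>n. 0) \<le> liminf ?u"
    by (rule Liminf_mono) simp
  moreover have "liminf ?u \<le> limsup ?u"
    by (rule Liminf_le_Limsup) simp
  ultimately have "0 \<le> limsup ?u" "limsup ?u \<le> 1"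
    by (simp_all add: Limsup_const Liminf_const)
  then show ?thesis
    unfolding besicovitch_dist_def by (cases "limsup ?u") auto
qed

lemma besicovitch_dist_commute: "besicovitch_dist F x y = besicovitch_dist F y x"
proof -
  have "{g \<in> F n. x g \<noteq> y g} = {g \<in> F n. y g \<noteq> x g}" for n
    by blast
  then show ?thesis
    unfolding besicovitch_dist_def by (simp only:)
qed

lemma besicovitch_dist_refl: "besicovitch_dist F x x = 0"
  unfolding besicovitch_dist_def by (simp add: Limsup_const flip: zero_ereal_def)

lemma besicovitch_dist_triangle:
  assumes "\<And>n. finite (F n)"
  shows "besicovitch_dist F x z \<le> besicovitch_dist F x y + besicovitch_dist F y z"
proof -
  let ?c = "\<lambda>x y n. card {g \<in> F n. x g \<noteq> y g}"
  let ?u = "\<lambda>x y n. ereal (real (?c x y n) / real (card (F n)))"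
  have "?c x z n \<le> ?c x y n + ?c y z n" for n
  proof -
    have "?c x z n \<le> card ({g \<in> F n. x g \<noteq> y g} \<union> {g \<in> F n. y g \<noteq> z g})"
      by (rule card_mono) (use assms in auto)
    then show ?thesis
      using card_Un_le order_trans by blast
  qed
  then have "real (?c x z n) / real (card (F n)) \<le>
      real (?c x y n) / real (card (F n)) + real (?c y z n) / real (card (F n))" for n
    by (simp flip: add_divide_distrib add: divide_right_mono flip: of_nat_add)
  then have "limsup (?u x z) \<le> limsup (\<lambda>n. ?u x y n + ?u y z n)"
    by (intro Limsup_mono) simp
  also have "\<dots> \<le> limsup (?u x y) + limsup (?u y z)"
    by (rule ereal_limsup_add_mono)
  finally show ?thesis
    by (simp only: besicovitch_limsup[OF assms, symmetric] plus_ereal.simps ereal_less_eq)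
qed

lemma class_dist_eq:
  assumes "folner_sequence G F" "x \<in> arrays G" "y \<in> arrays G"
  shows "class_dist F (besicovitch_rel G F `` {x}) (besicovitch_rel G F `` {y}) =
    besicovitch_dist F x y"
proof -
  have fin: "finite (F n)" for n
    using assms(1) by (simp add: folner_sequence_def)
  have tri: "besicovitch_dist F u w \<le> besicovitch_dist F u v + besicovitch_dist F v w" for u v w
    using fin by (rule besicovitch_dist_triangle)
  have "besicovitch_dist F x' y' = besicovitch_dist F x y"
    if "besicovitch_dist F x x' = 0" "besicovitch_dist F y y' = 0" for x' y'
    using tri[of x' y' x] tri[of x y' y] tri[of x y x'] tri[of x' y y'] that
      besicovitch_dist_commute[of F x' x] besicovitch_dist_commute[of F y' y]
    by linarith
  then have "besicovitch_dist F x' y' = besicovitch_dist F x y"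
    if "x' \<in> besicovitch_rel G F `` {x}" "y' \<in> besicovitch_rel G F `` {y}" for x' y'
    using that by (simp add: besicovitch_rel_def)
  moreover have "x \<in> besicovitch_rel G F `` {x}" "y \<in> besicovitch_rel G F `` {y}"
    using assms(2,3) by (simp_all add: besicovitch_rel_def besicovitch_dist_refl)
  ultimately have "(\<Union>x'\<in>besicovitch_rel G F `` {x}. \<Union>y'\<in>besicovitch_rel G F `` {y}.
      {besicovitch_dist F x' y'}) = {besicovitch_dist F x y}"
    by blast
  then show ?thesis
    by (simp add: class_dist_def)
qed

end

theory Submission
  imports Defs
begin

text \<open>
  The group maps onto the integers, and the array is pulled back from a Toeplitz sequence on the
  integers.  Such a homomorphism \<open>\<phi>\<close> exists by \<open>torsion_free_nilpotent_onto_int\<close>: in a torsion-free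
  nilpotent group, commutators with values in the last nontrivial term of the lower central series
  (or, for an abelian group, the identity) give a nontrivial homomorphism to a central subgroup,
  and a nontrivial finitely generated torsion-free abelian group has nonzero homomorphisms to the
  integers.  Along every Folner sequence of the
  group the residue classes of \<open>\<phi>\<close> modulo \<open>N\<close> are equidistributed
  (\<open>residue_frequency\<close>), so the distances between pulled back arrays are governed by densities
  of periodic sets of integers, whatever the Folner sequence.

  The sequence is written in terms of the digits of \<open>k\<close> in a fixed base \<open>q\<close>.  For each place \<open>i\<close>
  the digits \<open>1, ..., u i\<close> are hole digits.  The symbol at \<open>k\<close> is decided by the first digit of
  \<open>k\<close> that is not a hole digit: it is \<open>True\<close> if this digit is 0 and \<open>False\<close> otherwise.  Thus \<open>k\<close>
  modulo \<open>q ^ n\<close> determines the symbol unless the last \<open>n\<close> digits are all hole digits, which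
  happens with density \<open>r n = u 0 * ... * u (n - 1) / q ^ n\<close>.  Since \<open>r n\<close> tends to 0, the sequence
  is regular.

  Every point of the orbit closure has a residue modulo \<open>q ^ n\<close> such that it agrees with the
  corresponding translate of the sequence off the holes.  Points with the same residue have
  distance at most \<open>r n\<close>, while shifts with different residues have distance at least \<open>r n / q\<close>
  (\<open>separation_of_translates\<close>).  So at the scale \<open>r n\<close> the separation number is \<open>q ^ n\<close>
  (\<open>separation_number_upper\<close>, \<open>separation_number_lower\<close>).  It remains to choose \<open>u\<close> such that \<open>r n\<close>
  equals \<open>q powr (- n / a)\<close> up to a constant factor.  The density \<open>r n\<close> cannot be smaller than
  \<open>1 / q ^ n\<close>, which is where \<open>a \<ge> 1\<close> enters; and hole digits must be fewer than \<open>q / 2\<close>, which a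
  large base \<open>q\<close> permits for every finite \<open>a\<close>.
\<close>

section \<open>Homomorphisms onto the integers\<close>

text \<open>
  If a power of \<open>a\<close> already lies in \<open>H\<close>, an extension to \<open>a\<close> would need division by \<open>m\<close>.
  Multiplying \<open>\<psi>\<close> by \<open>m\<close> first keeps the values integral, and the result is simply
  \<open>x \<mapsto> \<psi> (x [^] m)\<close>, defined on every \<open>x\<close> whose \<open>m\<close>-th power lies in \<open>H\<close>.
\<close>
lemma (in comm_group) extend_hom_into_int_by_root:
  fixes \<psi> :: "'a \<Rightarrow> int" and m :: nat
  assumes H: "subgroup H G" and \<psi>: "\<And>x y. x \<in> H \<Longrightarrow> y \<in> H \<Longrightarrow> \<psi> (x \<otimes> y) = \<psi> x + \<psi> y"
    and m: "m > 0" and s: "s \<in> H" "\<psi> s \<noteq> 0" and a: "a \<in> carrier G" "a [^] m \<in> H"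
  shows "\<exists>H' \<psi>'. subgroup H' G \<and> H \<subseteq> H' \<and> a \<in> H' \<and>
    (\<forall>x\<in>H'. \<forall>y\<in>H'. \<psi>' (x \<otimes> y) = \<psi>' x + (\<psi>' y :: int)) \<and> \<psi>' s \<noteq> 0"
proof (intro exI conjI ballI)
  let ?H' = "{x \<in> carrier G. x [^] m \<in> H}"
  interpret H: subgroup H G by (rule H)
  have pow: "x [^] n \<in> H \<and> \<psi> (x [^] n) = int n * \<psi> x" if "x \<in> H" for x and n :: nat
  proof (induction n)
    case 0
    have "\<psi> (\<one> \<otimes> \<one>) = \<psi> \<one> + \<psi> \<one>" by (rule \<psi>) simp_all
    then show ?case by simp
  next
    case (Suc n)
    then show ?case using that by (simp add: \<psi> algebra_simps)
  qed
  show "subgroup ?H' G"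
    by (rule subgroupI) (auto simp: nat_pow_distrib nat_pow_inv intro!: exI[of _ \<one>])
  show "H \<subseteq> ?H'" using pow by auto
  show "a \<in> ?H'" using a by simp
  show "\<psi> ((x \<otimes> y) [^] m) = \<psi> (x [^] m) + \<psi> (y [^] m)" if "x \<in> ?H'" "y \<in> ?H'" for x y
    using that by (simp add: nat_pow_distrib \<psi>)
  show "\<psi> (s [^] m) \<noteq> 0" using pow[OF s(1), of m] s m by simp
qed

text \<open>
  If no power of \<open>a\<close> lies in \<open>H\<close>, then \<open>H\<close> and \<open>a\<close> generate a direct product, and the value at
  \<open>a\<close> may be prescribed.  With \<open>H\<close> trivial this starts a homomorphism at an element of
  infinite order.
\<close>
lemma (in comm_group) extend_hom_into_int_freely:
  fixes \<psi> :: "'a \<Rightarrow> int"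
  assumes H: "subgroup H G" and \<psi>: "\<And>x y. x \<in> H \<Longrightarrow> y \<in> H \<Longrightarrow> \<psi> (x \<otimes> y) = \<psi> x + \<psi> y"
    and a: "a \<in> carrier G" "\<And>m::nat. m > 0 \<Longrightarrow> a [^] m \<notin> H"
  shows "\<exists>H' \<psi>'. subgroup H' G \<and> H \<subseteq> H' \<and> a \<in> H' \<and>
    (\<forall>x\<in>H'. \<forall>y\<in>H'. \<psi>' (x \<otimes> y) = \<psi>' x + (\<psi>' y :: int)) \<and> (\<forall>h\<in>H. \<psi>' h = \<psi> h) \<and> \<psi>' a = 1"
proof -
  interpret H: subgroup H G by (rule H)
  let ?el = "\<lambda>h (j::int). h \<otimes> a [^] j"
  define H' where "H' = {?el h j | h j. h \<in> H}"
  define \<psi>' where "\<psi>' x = (THE k. \<exists>h\<in>H. \<exists>j::int. x = ?el h j \<and> k = \<psi> h + j)" for x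
  have one: "\<psi> \<one> = 0"
    using \<psi>[of \<one> \<one>] by simp
  have no_power: "j = 0" if "a [^] j \<in> H" for j :: int
  proof (rule ccontr)
    assume "j \<noteq> 0"
    then consider "j > 0" | "j < 0" by linarith
    then show False
    proof cases
      case 1
      then have "a [^] (nat j) \<in> H" using that by (simp add: pow_nat)
      then show False using a(2)[of "nat j"] 1 by simp
    next
      case 2
      have "inv (a [^] j) \<in> H" using that by simp
      then have "a [^] (- j) \<in> H" using a(1) by (simp add: int_pow_neg)
      then have "a [^] (nat (- j)) \<in> H" using 2 by (simp add: pow_nat)
      then show False using a(2)[of "nat (- j)"] 2 by simp
    qed
  qed
  have unique: "h = h' \<and> j = j'" if "h \<in> H" "h' \<in> H" "?el h j = ?el h' j'" for h h' j j'
  proof -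
    have hc: "h \<in> carrier G" "h' \<in> carrier G" using that by auto
    have "a [^] (j - j') = a [^] j \<otimes> inv (a [^] j')"
      using a(1) by (simp add: int_pow_diff)
    also have "\<dots> = inv h \<otimes> (?el h j) \<otimes> inv (a [^] j')"
      using hc a(1) by (simp add: m_assoc[symmetric])
    also have "\<dots> = inv h \<otimes> h'"
      unfolding that(3) using hc a(1) by (simp add: m_assoc)
    finally have "a [^] (j - j') \<in> H" using that by simp
    then have "j = j'" using no_power by fastforce
    then show ?thesis using that hc a(1) by simp
  qed
  have val: "\<psi>' (?el h j) = \<psi> h + j" if "h \<in> H" for h j
    unfolding \<psi>'_def using that unique by (intro the_equality) blast+
  have mult: "?el h j \<otimes> ?el h' j' = ?el (h \<otimes> h') (j + j')"
    if "h \<in> H" "h' \<in> H" for h h' j j'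
  proof -
    have "h \<in> carrier G" "h' \<in> carrier G" using that by auto
    then show ?thesis using a(1) by (simp add: int_pow_mult m_ac)
  qed
  have "subgroup H' G"
  proof (rule subgroupI)
    show "H' \<subseteq> carrier G" using a(1) by (auto simp: H'_def)
    show "H' \<noteq> {}" using H.one_closed unfolding H'_def by blast
    show "inv x \<in> H'" if x: "x \<in> H'" for x
    proof -
      obtain h j where hj: "h \<in> H" "x = ?el h j" using x by (auto simp: H'_def)
      then have "h \<in> carrier G" by auto
      then have "inv x = ?el (inv h) (- j)"
        using hj a(1) by (simp add: inv_mult int_pow_neg)
      then show ?thesis using hj unfolding H'_def by blast
    qed
    show "x \<otimes> y \<in> H'" if xy: "x \<in> H'" "y \<in> H'" for x y
    proof -
      obtain h j h' j' where "h \<in> H" "x = ?el h j" "h' \<in> H" "y = ?el h' j'"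
        using xy by (auto simp: H'_def)
      moreover from this have "h \<otimes> h' \<in> H" by simp
      ultimately show ?thesis using mult unfolding H'_def by blast
    qed
  qed
  moreover have el0: "h = ?el h 0" if "h \<in> H" for h using that H.mem_carrier by simp
  have ela: "a = ?el \<one> 1" using a(1) by simp
  have "H \<subseteq> H'" using el0 unfolding H'_def by blast
  moreover have "a \<in> H'" using ela H.one_closed unfolding H'_def by blast
  moreover have "\<psi>' (x \<otimes> y) = \<psi>' x + \<psi>' y" if xy: "x \<in> H'" "y \<in> H'" for x y
  proof -
    obtain h j h' j' where "h \<in> H" "x = ?el h j" "h' \<in> H" "y = ?el h' j'"
      using xy by (auto simp: H'_def)
    then show ?thesis by (simp add: mult val \<psi>)
  qed
  moreover have "\<psi>' h = \<psi> h" if "h \<in> H" for h using val[OF that, of 0] el0[OF that] by simp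
  moreover have "\<psi>' a = 1" using val[OF H.one_closed, of 1] ela one by simp
  ultimately show ?thesis by blast
qed

text \<open>
  The generators are adjoined one at a time; neither kind of extension makes the value at
  \<open>s\<close> vanish.
\<close>
lemma (in comm_group) hom_into_int_nonzero_at:
  assumes "torsion_free_group G" and s: "s \<in> carrier G" "s \<noteq> \<one>"
    and S: "finite S" "S \<subseteq> carrier G"
  shows "\<exists>H \<psi>. subgroup H G \<and> insert s S \<subseteq> H \<and>
    (\<forall>x\<in>H. \<forall>y\<in>H. \<psi> (x \<otimes> y) = \<psi> x + (\<psi> y :: int)) \<and> \<psi> s \<noteq> 0"
  using S
proof (induction S rule: finite_induct)
  case empty
  have "s [^] m \<notin> {\<one>}" if "m > 0" for m :: nat
    using assms(1) s that by (simp add: torsion_free_group_def)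
  then obtain H \<psi> where "subgroup H G" "s \<in> H"
    "\<forall>x\<in>H. \<forall>y\<in>H. \<psi> (x \<otimes> y) = \<psi> x + (\<psi> y :: int)" "\<psi> s = 1"
    using extend_hom_into_int_freely[where H = "{\<one>}" and \<psi> = "\<lambda>_. 0" and a = s, OF triv_subgroup] s(1)
    by auto
  moreover from this have "\<psi> s \<noteq> 0" by simp
  ultimately show ?case by blast
next
  case (insert a S)
  then obtain H \<psi> where H: "subgroup H G" "insert s S \<subseteq> H"
    and "\<forall>x\<in>H. \<forall>y\<in>H. \<psi> (x \<otimes> y) = \<psi> x + (\<psi> y :: int)" and s0: "\<psi> s \<noteq> 0"
    by (metis insert_subset)
  then have \<psi>: "\<And>x y. x \<in> H \<Longrightarrow> y \<in> H \<Longrightarrow> \<psi> (x \<otimes> y) = \<psi> x + \<psi> y" by blast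
  have a: "a \<in> carrier G" and sH: "s \<in> H" using insert.prems H by auto
  show ?case
  proof (cases "\<exists>m::nat. m > 0 \<and> a [^] m \<in> H")
    case True
    then obtain m :: nat where m: "m > 0" "a [^] m \<in> H" by blast
    from extend_hom_into_int_by_root[OF H(1) \<psi> m(1) sH s0 a m(2)] H(2)
    show ?thesis by blast
  next
    case False
    then have na: "\<And>m::nat. m > 0 \<Longrightarrow> a [^] m \<notin> H" by blast
    from extend_hom_into_int_freely[OF H(1) \<psi> a na]
    obtain H' \<psi>' where "subgroup H' G" "H \<subseteq> H'" "a \<in> H'"
      "\<forall>x\<in>H'. \<forall>y\<in>H'. \<psi>' (x \<otimes> y) = \<psi>' x + (\<psi>' y :: int)" "\<forall>h\<in>H. \<psi>' h = \<psi> h"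
      by blast
    moreover from this have "\<psi>' s \<noteq> 0" using sH s0 by simp
    ultimately show ?thesis using H(2) by blast
  qed
qed

lemma (in group) lower_central_series_carrier: "lower_central_series G n \<subseteq> carrier G"
proof (induction n)
  case (Suc n)
  have "generate G (\<Union>h\<in>lower_central_series G n. \<Union>g\<in>carrier G. {h \<otimes> g \<otimes> inv h \<otimes> inv g})
    \<subseteq> carrier G"
    by (rule generate_incl) (use Suc in auto)
  then show ?case by simp
qed simp

text \<open>
  The last nontrivial term of the lower central series is central.  If it is the whole group,
  the identity will do.  Otherwise it is generated by commutators, and for fixed \<open>h\<close> a map
  \<open>g \<mapsto> h \<otimes> g \<otimes> inv h \<otimes> inv g\<close> with central values is a homomorphism; one of these is nontrivial.
\<close>
lemma (in group) torsion_free_nilpotent_central_endomorphism: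
  assumes "carrier G \<noteq> {\<one>}" and "nilpotent_group G"
  obtains f where "f \<in> hom G G" "\<And>g k. g \<in> carrier G \<Longrightarrow> k \<in> carrier G \<Longrightarrow> f g \<otimes> k = k \<otimes> f g"
    "\<exists>g\<in>carrier G. f g \<noteq> \<one>"
proof -
  let ?L = "lower_central_series G"
  let ?c = "\<lambda>h g. h \<otimes> g \<otimes> inv h \<otimes> inv g"
  define N where "N = (LEAST n. ?L n = {\<one>})"
  have N: "?L N = {\<one>}"
    unfolding N_def by (rule LeastI_ex) (use assms(2) in \<open>simp add: nilpotent_group_def\<close>)
  with assms(1) obtain m where m: "N = Suc m" by (cases N) auto
  have Lm: "?L m \<noteq> {\<one>}"
    using not_less_Least[of m "\<lambda>n. ?L n = {\<one>}"] m by (auto simp: N_def)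
  have car: "h \<in> ?L n \<Longrightarrow> h \<in> carrier G" for h n
    using lower_central_series_carrier by blast
  have comm_mem: "?c h g \<in> ?L (Suc n)" if "h \<in> ?L n" "g \<in> carrier G" for h g n
    unfolding lower_central_series.simps by (rule generate.incl) (use that in blast)
  have central: "z \<otimes> k = k \<otimes> z" if z: "z \<in> ?L m" and k: "k \<in> carrier G" for z k
  proof -
    have zc: "z \<in> carrier G" using car z .
    have "?c z k = \<one>" using comm_mem[OF z k] N m by blast
    then have "z \<otimes> k \<otimes> inv z \<otimes> inv k \<otimes> k \<otimes> z = k \<otimes> z" using zc k by (simp add: m_assoc)
    then show ?thesis using zc k by (simp add: m_assoc)
  qed
  show thesis
  proof (cases m)
    case 0
    show thesis
    proof (rule that[of "\<lambda>g. g"])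
      show "\<exists>g\<in>carrier G. g \<noteq> \<one>" using assms(1) by auto
    qed (use central 0 in \<open>auto simp: hom_def\<close>)
  next
    case (Suc l)
    have "\<exists>h\<in>?L l. \<exists>g\<in>carrier G. ?c h g \<noteq> \<one>"
    proof (rule ccontr)
      assume "\<not> ?thesis"
      then have "(\<Union>h\<in>?L l. \<Union>g\<in>carrier G. {?c h g}) \<subseteq> {\<one>}" by auto
      then have "?L m \<subseteq> {\<one>}"
        unfolding Suc lower_central_series.simps
        by (rule generate_subgroup_incl[OF _ triv_subgroup])
      moreover have "\<one> \<in> ?L m" unfolding Suc lower_central_series.simps by (rule generate.one)
      ultimately show False using Lm by blast
    qed
    then obtain h g0 where h: "h \<in> ?L l" and g0: "g0 \<in> carrier G" "?c h g0 \<noteq> \<one>" by blast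
    have hc: "h \<in> carrier G" using car h .
    have mem: "?c h g \<in> ?L m" if "g \<in> carrier G" for g
      unfolding Suc by (rule comm_mem[OF h that])
    show thesis
    proof (rule that[of "?c h"])
      show "?c h \<in> hom G G"
      proof (rule homI)
        fix g k assume gk: "g \<in> carrier G" "k \<in> carrier G"
        have cancel: "inv h \<otimes> (h \<otimes> z) = z" if "z \<in> carrier G" for z
          using hc that by (simp flip: m_assoc)
        have "?c h (g \<otimes> k) = h \<otimes> g \<otimes> inv h \<otimes> (?c h k \<otimes> inv g)"
          using hc gk by (simp add: m_assoc inv_mult_group cancel)
        also have "?c h k \<otimes> inv g = inv g \<otimes> ?c h k"
          using central[OF mem[OF gk(2)], of "inv g"] gk by simp
        also have "h \<otimes> g \<otimes> inv h \<otimes> (inv g \<otimes> ?c h k) = ?c h g \<otimes> ?c h k"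
          using hc gk by (simp add: m_assoc)
        finally show "?c h (g \<otimes> k) = ?c h g \<otimes> ?c h k" .
      qed (use hc in simp)
      show "?c h g \<otimes> k = k \<otimes> ?c h g" if "g \<in> carrier G" "k \<in> carrier G" for g k
        by (rule central[OF mem[OF that(1)] that(2)])
      show "\<exists>g\<in>carrier G. ?c h g \<noteq> \<one>" using g0 by blast
    qed
  qed
qed

text \<open>
  The image of the central endomorphism is abelian, finitely generated, torsion-free and
  nontrivial, so it has a nonzero homomorphism to the integers.  The values of the composition
  are the multiples of the least positive one, and division by it makes the map onto.
\<close>
lemma (in group) torsion_free_nilpotent_onto_int:
  assumes "carrier G \<noteq> {\<one>}" "finitely_generated_group G" "torsion_free_group G" "nilpotent_group G"
  obtains \<phi> :: "'a \<Rightarrow> int" where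
    "\<And>x y. x \<in> carrier G \<Longrightarrow> y \<in> carrier G \<Longrightarrow> \<phi> (x \<otimes> y) = \<phi> x + \<phi> y"
    "\<exists>t\<in>carrier G. \<phi> t = 1"
proof -
  obtain f where f: "f \<in> hom G G" and central: "\<And>g k. g \<in> carrier G \<Longrightarrow> k \<in> carrier G \<Longrightarrow> f g \<otimes> k = k \<otimes> f g"
    and nontriv: "\<exists>g\<in>carrier G. f g \<noteq> \<one>"
    using torsion_free_nilpotent_central_endomorphism[OF assms(1,4)] by blast
  interpret f: group_hom G G f by unfold_locales (rule f)
  define A where "A = G\<lparr>carrier := f ` carrier G\<rparr>"
  have sub: "subgroup (f ` carrier G) G" by (rule f.img_is_subgroup)
  interpret A: group A unfolding A_def by (rule subgroup.subgroup_is_group[OF sub is_group])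
  interpret A: comm_group A
  proof (rule A.group_comm_groupI)
    fix x y assume "x \<in> carrier A" "y \<in> carrier A"
    then obtain g where "g \<in> carrier G" "x = f g" "y \<in> carrier G" by (auto simp: A_def)
    then show "x \<otimes>\<^bsub>A\<^esub> y = y \<otimes>\<^bsub>A\<^esub> x" using central[of g y] by (simp add: A_def)
  qed
  have powA: "x [^]\<^bsub>A\<^esub> n = x [^] n" for x and n :: nat
    unfolding A_def by (rule nat_pow_consistent[symmetric])
  have tfA: "torsion_free_group A"
    using assms(3) sub[THEN subgroup.subset] unfolding torsion_free_group_def powA by (auto simp: A_def)
  obtain S where S: "finite S" "S \<subseteq> carrier G" "generate G S = carrier G"
    using assms(2) by (auto simp: finitely_generated_group_def)
  obtain g0 where g0: "g0 \<in> carrier G" "f g0 \<noteq> \<one>" using nontriv by blast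
  have s: "f g0 \<in> carrier A" "f g0 \<noteq> \<one>\<^bsub>A\<^esub>" "finite (f ` S)" "f ` S \<subseteq> carrier A"
    using g0 S by (auto simp: A_def)
  obtain H \<psi> where H: "subgroup H A" "insert (f g0) (f ` S) \<subseteq> H"
    and "\<forall>x\<in>H. \<forall>y\<in>H. \<psi> (x \<otimes>\<^bsub>A\<^esub> y) = \<psi> x + (\<psi> y :: int)" and s0: "\<psi> (f g0) \<noteq> 0"
    using A.hom_into_int_nonzero_at[OF tfA s] by metis
  then have \<psi>: "\<And>x y. x \<in> H \<Longrightarrow> y \<in> H \<Longrightarrow> \<psi> (x \<otimes> y) = \<psi> x + \<psi> y" by (simp add: A_def)
  have HG: "subgroup H G"
    using incl_subgroup[OF sub] H(1) by (simp add: A_def)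
  interpret HG: subgroup H G by (rule HG)
  have "subgroup {g \<in> carrier G. f g \<in> H} G"
    by (rule subgroupI) (auto intro!: exI[of _ \<one>])
  then have "generate G S \<subseteq> {g \<in> carrier G. f g \<in> H}"
    by (rule generate_subgroup_incl[rotated]) (use S H in auto)
  then have inH: "f g \<in> H" if "g \<in> carrier G" for g using S(3) that by auto
  define \<eta> where "\<eta> g = \<psi> (f g)" for g
  have \<eta>: "\<eta> (x \<otimes> y) = \<eta> x + \<eta> y" if "x \<in> carrier G" "y \<in> carrier G" for x y
    using that by (simp add: \<eta>_def \<psi> inH)
  have \<eta>1: "\<eta> \<one> = 0" using \<eta>[of \<one> \<one>] by simp
  have \<eta>inv: "\<eta> (inv x) = - \<eta> x" if "x \<in> carrier G" for x
    using \<eta>[of x "inv x"] that \<eta>1 by simp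
  have \<eta>pow: "\<eta> (x [^] n) = int n * \<eta> x" if "x \<in> carrier G" for x and n :: nat
    by (induction n) (use that \<eta>1 in \<open>simp_all add: \<eta> algebra_simps\<close>)
  define d where "d = (LEAST n. n > 0 \<and> (\<exists>g\<in>carrier G. \<eta> g = int n))"
  have "\<exists>g\<in>carrier G. \<eta> g = int (nat \<bar>\<eta> g0\<bar>)"
    using g0(1) \<eta>inv[OF g0(1)] by (cases "\<eta> g0 \<ge> 0") (force, intro bexI[of _ "inv g0"], auto)
  then have "\<exists>n>0. \<exists>g\<in>carrier G. \<eta> g = int n"
    using s0 by (intro exI[of _ "nat \<bar>\<eta> g0\<bar>"]) (simp add: \<eta>_def)
  then have "d > 0 \<and> (\<exists>g\<in>carrier G. \<eta> g = int d)"
    unfolding d_def by (rule LeastI_ex)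
  then obtain t where d: "d > 0" and t: "t \<in> carrier G" "\<eta> t = int d" by blast
  have dvd: "int d dvd \<eta> g" if g: "g \<in> carrier G" for g
  proof (rule ccontr)
    assume nd: "\<not> int d dvd \<eta> g"
    define e where "e = \<eta> g div int d"
    \<comment> \<open>\<open>g\<close> times a power of \<open>t\<close> or of its inverse has the value \<open>\<eta> g mod d\<close>, which is below \<open>d\<close>.\<close>
    have "\<exists>w\<in>carrier G. \<eta> w = k * int d" for k
    proof (cases k rule: int_cases2)
      case (nonneg n)
      then show ?thesis using t by (intro bexI[of _ "t [^] n"]) (simp_all add: \<eta>pow)
    next
      case (nonpos n)
      then show ?thesis using t by (intro bexI[of _ "inv t [^] n"]) (simp_all add: \<eta>pow \<eta>inv)
    qed
    then obtain w where w: "w \<in> carrier G" "\<eta> w = (- e) * int d" by blast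
    have "\<eta> (g \<otimes> w) = \<eta> g mod int d"
      using g w by (simp add: \<eta> e_def minus_div_mult_eq_mod)
    moreover have "\<eta> g mod int d > 0"
      using nd d by (metis dvd_eq_mod_eq_0 of_nat_0_less_iff order_less_le pos_mod_sign)
    moreover have "\<eta> g mod int d < int d" using d by simp
    ultimately have "nat (\<eta> g mod int d) < d" "nat (\<eta> g mod int d) > 0 \<and>
      (\<exists>k\<in>carrier G. \<eta> k = int (nat (\<eta> g mod int d)))"
      using g w by (auto intro!: bexI[of _ "g \<otimes> w"])
    then show False
      using not_less_Least[of "nat (\<eta> g mod int d)" "\<lambda>n. n > 0 \<and> (\<exists>g\<in>carrier G. \<eta> g = int n)"]
      by (simp add: d_def)
  qed
  show thesis
  proof (rule that[of "\<lambda>g. \<eta> g div int d"])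
    show "\<eta> (x \<otimes> y) div int d = \<eta> x div int d + \<eta> y div int d"
      if "x \<in> carrier G" "y \<in> carrier G" for x y
      using that by (simp add: \<eta> dvd div_plus_div_distrib_dvd_left)
    show "\<exists>t\<in>carrier G. \<eta> t div int d = 1" using t d by (intro bexI[of _ t]) auto
  qed
qed


section \<open>Toeplitz sequences with digit holes\<close>

definition digit :: "int \<Rightarrow> nat \<Rightarrow> int \<Rightarrow> int" where
  "digit q i k = (k div q ^ i) mod q"

text \<open>
  Position \<open>k\<close> is a hole of level \<open>n\<close> if its last \<open>n\<close> digits in base \<open>q\<close> leave the symbol at
  \<open>k\<close> open.  Negative numbers have the digits of the \<open>q\<close>-adic integers, ending in \<open>q - 1\<close> forever.
\<close>
definition holes :: "int \<Rightarrow> (nat \<Rightarrow> int) \<Rightarrow> nat \<Rightarrow> int set" where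
  "holes q u n = {k. \<forall>i<n. digit q i k \<in> {1..u i}}"

definition hole_sequence :: "int \<Rightarrow> (nat \<Rightarrow> int) \<Rightarrow> int \<Rightarrow> bool" where
  "hole_sequence q u k \<longleftrightarrow> (\<exists>n. k \<in> holes q u n \<and> digit q n k = 0)"

text \<open>
  The bound \<open>2 * u i < q\<close> serves two ends.  It keeps the digit \<open>q - 1\<close> out of the hole
  range, so that negative integers, too, stop being holes; and it prevents a nonzero digit and its
  negative modulo \<open>q\<close> from both being hole digits, which separates translates.
\<close>
locale hole_digits =
  fixes q :: int and u :: "nat \<Rightarrow> int"
  assumes u_ge_1: "1 \<le> u i" and two_u: "2 * u i < q"
begin

abbreviation "H \<equiv> holes q u"
abbreviation "y \<equiv> hole_sequence q u"

lemma q_ge_3: "3 \<le> q"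
  using u_ge_1[of 0] two_u[of 0] by linarith

lemma digit_top: "digit q n (k + q ^ n * c) = (digit q n k + c) mod q"
  using q_ge_3 by (simp add: digit_def mod_simps add.commute)

lemma digit_eq_div:
  assumes "0 \<le> k" "k < q ^ Suc n"
  shows "digit q n k = k div q ^ n"
proof -
  have qn: "q ^ n > 0" using q_ge_3 by simp
  have "k div q ^ n < q"
  proof (rule ccontr)
    assume "\<not> ?thesis"
    then have "q * q ^ n \<le> (k div q ^ n) * q ^ n" using qn by (intro mult_right_mono) auto
    also have "\<dots> \<le> k" using qn by (simp flip: minus_mod_eq_div_mult)
    finally show False using assms by simp
  qed
  then show ?thesis
    using assms qn by (simp add: digit_def pos_imp_zdiv_nonneg_iff mod_pos_pos_trivial)
qed

lemma digit_low: "i < n \<Longrightarrow> digit q i (k + q ^ n * c) = digit q i k"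
proof -
  assume "i < n"
  then obtain d where "n = Suc (i + d)" using less_imp_Suc_add by blast
  then have "k + q ^ n * c = k + q ^ i * (q * (q ^ d * c))" by (simp add: power_add algebra_simps)
  then show ?thesis using q_ge_3 by (simp only: digit_def) simp
qed

lemma holes_periodic: "k + q ^ n * c \<in> H n \<longleftrightarrow> k \<in> H n"
  by (simp add: holes_def digit_low)

lemma holes_antimono: "m \<le> n \<Longrightarrow> H n \<subseteq> H m"
  by (auto simp: holes_def)

lemma hole_sequence_periodic:
  assumes "k \<notin> H n"
  shows "y (k + q ^ n * c) \<longleftrightarrow> y k"
proof -
  have below: "y l \<longleftrightarrow> (\<exists>j<n. l \<in> H j \<and> digit q j l = 0)" if "l \<notin> H n" for l
    unfolding hole_sequence_def using that holes_antimono by (metis leI subsetD)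
  have "k + q ^ n * c \<in> H j \<longleftrightarrow> k \<in> H j" if "j < n" for j
    using that by (simp add: holes_def digit_low)
  then show ?thesis
    using below[of k] below[of "k + q ^ n * c"] assms by (auto simp: holes_periodic digit_low)
qed

lemma eventually_not_hole: "\<exists>n. k \<notin> H n"
proof -
  have "\<bar>k\<bar> < q ^ nat \<bar>k\<bar>"
  proof -
    have "int (nat \<bar>k\<bar>) < 2 ^ nat \<bar>k\<bar>"
      by (rule of_nat_less_two_power)
    also have "\<dots> \<le> q ^ nat \<bar>k\<bar>" using q_ge_3 by (intro power_mono) auto
    finally show ?thesis by simp
  qed
  then obtain n where n: "\<bar>k\<bar> < q ^ n" by blast
  have "digit q n k \<notin> {1..u n}"
  proof (cases "k \<ge> 0")
    case True
    then show ?thesis using n by (simp add: digit_def div_pos_pos_trivial)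
  next
    case False
    have "k div q ^ n = -1" using n False by (intro int_div_pos_eq[where r = "k + q ^ n"]) auto
    moreover have "(-1) mod q = q - 1" using q_ge_3 by (simp add: zmod_minus1)
    ultimately show ?thesis using two_u[of n] u_ge_1[of n] by (simp add: digit_def)
  qed
  then have "k \<notin> H (Suc n)" by (auto simp: holes_def)
  then show ?thesis ..
qed

text \<open>
  The first digit outside its hole range decides the symbol: digit \<open>0\<close> gives \<open>True\<close>, any
  other gives \<open>False\<close>.
\<close>
lemma hole_value_top:
  assumes "k \<in> H n" "digit q n k \<notin> {1..u n}"
  shows "y k \<longleftrightarrow> digit q n k = 0"
proof -
  have "j = n" if "k \<in> H j" "digit q j k = 0" for j
  proof (rule linorder_cases[of j n])
    assume "j < n"
    then have "digit q j k \<ge> 1" using assms(1) by (simp add: holes_def)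
    then show ?thesis using that by simp
  next
    assume "n < j"
    then show ?thesis using that assms(2) by (simp add: holes_def)
  qed
  then show ?thesis unfolding hole_sequence_def using assms(1) by blast
qed

lemma card_holes: "card (H n \<inter> {0..<q ^ n}) = nat (\<Prod>i<n. u i)"
proof (induction n)
  case 0
  then show ?case by (simp add: holes_def)
next
  case (Suc n)
  let ?f = "\<lambda>(k, t). k + q ^ n * t"
  have qn: "q ^ n > 0" using q_ge_3 by simp
  have "bij_betw ?f ((H n \<inter> {0..<q ^ n}) \<times> {1..u n}) (H (Suc n) \<inter> {0..<q ^ Suc n})"
  proof (rule bij_betw_byWitness[where f' = "\<lambda>k. (k mod q ^ n, k div q ^ n)"])
    show "\<forall>p\<in>(H n \<inter> {0..<q ^ n}) \<times> {1..u n}. (?f p mod q ^ n, ?f p div q ^ n) = p"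
      using qn by (auto simp: div_mult_self2[OF less_imp_neq[OF qn, symmetric]] div_pos_pos_trivial mod_pos_pos_trivial)
    show "\<forall>k\<in>H (Suc n) \<inter> {0..<q ^ Suc n}. ?f (k mod q ^ n, k div q ^ n) = k"
      by simp
    show "?f ` ((H n \<inter> {0..<q ^ n}) \<times> {1..u n}) \<subseteq> H (Suc n) \<inter> {0..<q ^ Suc n}"
    proof (rule image_subsetI)
      fix p assume "p \<in> (H n \<inter> {0..<q ^ n}) \<times> {1..u n}"
      then obtain k t where p: "p = (k, t)" and k: "k \<in> H n" "0 \<le> k" "k < q ^ n"
        and t: "1 \<le> t" "t \<le> u n" by auto
      have "digit q n (k + q ^ n * t) = t"
        using k t two_u[of n] by (simp add: digit_top) (simp add: digit_def div_pos_pos_trivial mod_pos_pos_trivial)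
      then have "k + q ^ n * t \<in> H (Suc n)"
        using k t holes_periodic[of k n t] by (simp add: holes_def less_Suc_eq)
      moreover have "k + q ^ n * t < q * q ^ n"
      proof -
        have "k + q ^ n * t < q ^ n * (t + 1)" using k by (simp add: algebra_simps)
        also have "\<dots> \<le> q ^ n * q" using t two_u[of n] u_ge_1[of n] qn by (intro mult_left_mono) auto
        finally show ?thesis by (simp add: mult.commute)
      qed
      ultimately show "?f p \<in> H (Suc n) \<inter> {0..<q ^ Suc n}"
        using p k t qn by simp
    qed
    show "(\<lambda>k. (k mod q ^ n, k div q ^ n)) ` (H (Suc n) \<inter> {0..<q ^ Suc n})
      \<subseteq> (H n \<inter> {0..<q ^ n}) \<times> {1..u n}"
    proof (rule image_subsetI)
      fix k assume "k \<in> H (Suc n) \<inter> {0..<q ^ Suc n}"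
      then have k: "k \<in> H (Suc n)" "0 \<le> k" "k < q * q ^ n" by auto
      have "digit q n k = k div q ^ n" using k by (simp add: digit_eq_div)
      moreover have "1 \<le> digit q n k \<and> digit q n k \<le> u n" using k(1) by (simp add: holes_def)
      moreover have "k mod q ^ n \<in> H n"
        using holes_periodic[of "k mod q ^ n" n "k div q ^ n"] holes_antimono[of n "Suc n"] k(1) by auto
      ultimately show "(k mod q ^ n, k div q ^ n) \<in> (H n \<inter> {0..<q ^ n}) \<times> {1..u n}"
        using qn by simp
    qed
  qed
  then have "card (H (Suc n) \<inter> {0..<q ^ Suc n}) = card (H n \<inter> {0..<q ^ n}) * nat (u n)"
    using bij_betw_same_card by fastforce
  then show ?case
    using Suc u_ge_1 by (simp add: nat_mult_distrib prod_nonneg order_trans[OF _ u_ge_1])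
qed

text \<open>
  The positions that receive the symbol \<open>True\<close> at step \<open>n\<close>: one in each block of \<open>q\<close> holes.
\<close>
definition first_holes :: "nat \<Rightarrow> int set" where
  "first_holes n = {k \<in> H n. digit q n k = 0}"

lemma first_holes_periodic: "k + q ^ Suc n * c \<in> first_holes n \<longleftrightarrow> k \<in> first_holes n"
  using holes_periodic[of k n "q * c"] digit_low[of n "Suc n" k c]
  by (simp add: first_holes_def mult.assoc mult.left_commute)

lemma card_first_holes: "card (first_holes n \<inter> {0..<q ^ Suc n}) = nat (\<Prod>i<n. u i)"
proof -
  have qn: "q ^ n > 0" using q_ge_3 by simp
  have "first_holes n \<inter> {0..<q ^ Suc n} = H n \<inter> {0..<q ^ n}"
  proof (intro equalityI subsetI)
    fix k assume "k \<in> first_holes n \<inter> {0..<q ^ Suc n}"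
    then have k: "k \<in> H n" "digit q n k = 0" "0 \<le> k" "k < q * q ^ n" by (auto simp: first_holes_def)
    then have "k div q ^ n = 0" using digit_eq_div[of k n] by simp
    then have "k < q ^ n" using k qn q_ge_3 by (auto simp: zdiv_eq_0_iff)
    then show "k \<in> H n \<inter> {0..<q ^ n}" using k by simp
  next
    fix k assume k: "k \<in> H n \<inter> {0..<q ^ n}"
    then have "k < q ^ n" by simp
    also have "\<dots> \<le> q ^ n * q" using qn q_ge_3 by simp
    finally show "k \<in> first_holes n \<inter> {0..<q ^ Suc n}"
      using k by (simp add: first_holes_def digit_def div_pos_pos_trivial mult.commute)
  qed
  then show ?thesis by (simp add: card_holes)
qed

text \<open>
  Let \<open>v\<close> be the first place where the digits of \<open>i - j\<close> do not vanish.  Moving from \<open>k + i\<close>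
  to \<open>k + j\<close>, or back, keeps a hole of level \<open>v\<close> a hole of level \<open>v\<close> and adds a fixed nonzero
  residue to its digit \<open>v\<close>.  In one of the two directions this residue is not a hole digit, and
  then a symbol \<open>True\<close> set at step \<open>v\<close> meets a symbol \<open>False\<close> set at the same step.
\<close>
lemma separation_of_translates:
  assumes "\<not> q ^ n dvd i - j"
  obtains v where "v < n"
    "(\<forall>k. k + i \<in> first_holes v \<longrightarrow> y (k + i) \<noteq> y (k + j)) \<or>
     (\<forall>k. k + j \<in> first_holes v \<longrightarrow> y (k + i) \<noteq> y (k + j))"
proof -
  define v where "v = (LEAST v. \<not> q ^ Suc v dvd i - j)"
  have "n \<noteq> 0" using assms by (cases n) auto
  then have ex: "\<not> q ^ Suc (n - 1) dvd i - j" using assms by simp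
  have v: "\<not> q ^ Suc v dvd i - j"
    unfolding v_def by (rule LeastI[of "\<lambda>v. \<not> q ^ Suc v dvd i - j", OF ex])
  have "v \<le> n - 1" unfolding v_def by (rule Least_le[of "\<lambda>v. \<not> q ^ Suc v dvd i - j", OF ex])
  with \<open>n \<noteq> 0\<close> have vn: "v < n" by simp
  have "q ^ v dvd i - j"
  proof (cases v)
    case (Suc w)
    then have "w < v" by simp
    then show ?thesis using Suc not_less_Least[of w "\<lambda>v. \<not> q ^ Suc v dvd i - j"] by (simp add: v_def)
  qed simp
  then obtain m where m: "i - j = q ^ v * m" by (rule dvdE)
  then have qm: "\<not> q dvd m" using v by (auto simp: mult.commute)
  have main: "\<forall>k. k + a \<in> first_holes v \<longrightarrow> y (k + a) \<noteq> y (k + b)"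
    if ab: "b - a = q ^ v * c" "c mod q \<notin> {1..u v}" "c mod q \<noteq> 0" for a b c
  proof (intro allI impI)
    fix k assume k: "k + a \<in> first_holes v"
    have b: "k + b = (k + a) + q ^ v * c" using ab(1) by simp
    have "digit q v (k + b) = c mod q"
      unfolding b digit_top using k by (simp add: first_holes_def)
    moreover have "k + b \<in> H v"
      unfolding b holes_periodic using k by (simp add: first_holes_def)
    ultimately have "\<not> y (k + b)" using hole_value_top[of "k + b" v] ab by simp
    moreover have "y (k + a)" using hole_value_top[of "k + a" v] k by (simp add: first_holes_def)
    ultimately show "y (k + a) \<noteq> y (k + b)" by simp
  qed
  have m0: "m mod q \<noteq> 0" "(- m) mod q \<noteq> 0" by (metis qm dvd_eq_mod_eq_0, metis qm dvd_eq_mod_eq_0 dvd_minus_iff)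
  show thesis
  proof (cases "m mod q \<in> {1..u v}")
    case False
    have "\<forall>k. k + j \<in> first_holes v \<longrightarrow> y (k + j) \<noteq> y (k + i)"
      by (rule main[OF m False m0(1)])
    then show thesis using that[OF vn] by metis
  next
    case True
    then have "(- m) mod q = q - m mod q" using m0 by (simp add: zmod_zminus1_eq_if)
    then have "(- m) mod q \<notin> {1..u v}" using True two_u[of v] by auto
    moreover have "j - i = q ^ v * (- m)" using m by simp
    ultimately have "\<forall>k. k + i \<in> first_holes v \<longrightarrow> y (k + i) \<noteq> y (k + j)"
      using main m0(2) by blast
    then show thesis using that[OF vn] by metis
  qed
qed

end


section \<open>Residue classes along Folner sequences\<close>

locale int_quotient = group G for G (structure) +
  fixes \<phi> :: "'a \<Rightarrow> int"
  assumes \<phi>_mult: "x \<in> carrier G \<Longrightarrow> y \<in> carrier G \<Longrightarrow> \<phi> (x \<otimes> y) = \<phi> x + \<phi> y"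
    and \<phi>_onto: "\<exists>t\<in>carrier G. \<phi> t = 1"
begin

lemma \<phi>_one: "\<phi> \<one> = 0"
  using \<phi>_mult[of \<one> \<one>] by simp

lemma \<phi>_inv: "x \<in> carrier G \<Longrightarrow> \<phi> (inv x) = - \<phi> x"
  using \<phi>_mult[of x "inv x"] by (simp add: \<phi>_one)

lemma \<phi>_surj: "\<exists>g\<in>carrier G. \<phi> g = k"
proof -
  obtain t where t: "t \<in> carrier G" "\<phi> t = 1" using \<phi>_onto by blast
  have pow: "\<phi> (x [^] n) = int n * \<phi> x" if "x \<in> carrier G" for x and n :: nat
    by (induction n) (use that in \<open>simp_all add: \<phi>_one \<phi>_mult algebra_simps\<close>)
  show ?thesis
  proof (cases k rule: int_cases2)
    case (nonneg n)
    then show ?thesis using t by (intro bexI[of _ "t [^] n"]) (simp_all add: pow)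
  next
    case (nonpos n)
    then show ?thesis using t by (intro bexI[of _ "inv t [^] n"]) (simp_all add: pow \<phi>_inv)
  qed
qed

text \<open>
  Translation by an element \<open>t\<close> with \<open>\<phi> t = 1\<close> carries each residue class to the next one and
  changes a Folner set only by a negligible part.  So all classes have asymptotically the same
  frequency.
\<close>
lemma residue_frequency:
  assumes F: "folner_sequence G F" and N: "N > 0"
  shows "(\<lambda>n. real (card {g \<in> F n. \<phi> g mod N = j mod N}) / real (card (F n)))
    \<longlonglongrightarrow> 1 / real_of_int N"
proof -
  have fin: "finite (F n)" and ne: "F n \<noteq> {}" and sub: "F n \<subseteq> carrier G" for n
    using F by (auto simp: folner_sequence_def)
  have cardpos: "card (F n) > 0" for n using fin ne by (simp add: card_gt_0_iff)
  obtain t where t: "t \<in> carrier G" "\<phi> t = 1" using \<phi>_onto by blast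
  define c where "c j n = real (card {g \<in> F n. \<phi> g mod N = j mod N}) / real (card (F n))" for j n
  let ?e = "\<lambda>n. real (card (sym_diff (t <# F n) (F n))) / real (card (F n))"
  have step_bound: "norm (c (j + 1) n - c j n) \<le> ?e n" for j n
  proof -
    let ?A = "{g \<in> F n. \<phi> g mod N = (j + 1) mod N}"
    let ?B = "{g \<in> t <# F n. \<phi> g mod N = (j + 1) mod N}"
    have tF: "t <# F n = (\<lambda>g. t \<otimes> g) ` F n" by (auto simp: l_coset_def)
    have mod1: "(1 + \<phi> g) mod N = (j + 1) mod N \<longleftrightarrow> \<phi> g mod N = j mod N" for g
      by (simp add: mod_eq_dvd_iff)
    have "?B = (\<lambda>g. t \<otimes> g) ` {g \<in> F n. \<phi> g mod N = j mod N}"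
      using sub[of n] t mod1 by (auto simp: tF \<phi>_mult subset_iff)
    moreover have "inj_on (\<lambda>g. t \<otimes> g) {g \<in> F n. \<phi> g mod N = j mod N}"
      by (rule inj_on_subset[OF inj_on_cmult[OF t(1)]]) (use sub in auto)
    ultimately have B: "card ?B = card {g \<in> F n. \<phi> g mod N = j mod N}"
      by (simp add: card_image)
    have finB: "finite (t <# F n)" using fin by (simp add: tF)
    have "card ?A \<le> card (?B \<union> sym_diff (t <# F n) (F n))"
      "card ?B \<le> card (?A \<union> sym_diff (t <# F n) (F n))"
      using fin[of n] finB by (auto intro!: card_mono)
    then have "card ?A \<le> card ?B + card (sym_diff (t <# F n) (F n))"
      "card ?B \<le> card ?A + card (sym_diff (t <# F n) (F n))"
      using card_Un_le order_trans by blast+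
    then have "\<bar>real (card ?A) - real (card ?B)\<bar> \<le> real (card (sym_diff (t <# F n) (F n)))"
      by linarith
    then have "\<bar>real (card ?A) - real (card ?B)\<bar> / real (card (F n)) \<le> ?e n"
      by (rule divide_right_mono) simp
    then show ?thesis
      by (simp add: c_def B flip: diff_divide_distrib)
  qed
  have e0: "?e \<longlonglongrightarrow> 0" using F t by (simp add: folner_sequence_def)
  have step: "(\<lambda>n. c (j + 1) n - c j n) \<longlonglongrightarrow> 0" for j
    by (rule Lim_null_comparison[OF always_eventually e0]) (use step_bound in blast)
  have from0: "(\<lambda>n. c (int k) n - c 0 n) \<longlonglongrightarrow> 0" for k
  proof (induction k)
    case (Suc k)
    have "(\<lambda>n. (c (int k + 1) n - c (int k) n) + (c (int k) n - c 0 n)) \<longlonglongrightarrow> 0 + 0"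
      by (intro tendsto_add step Suc)
    then show ?case by (simp add: add.commute)
  qed simp
  have sum1: "(\<Sum>j\<in>{0..<N}. c j n) = 1" for n
  proof -
    have "card (F n) = card (\<Union>j\<in>{0..<N}. {g \<in> F n. \<phi> g mod N = j mod N})"
    proof (rule arg_cong[where f = card])
      show "F n = (\<Union>j\<in>{0..<N}. {g \<in> F n. \<phi> g mod N = j mod N})"
        using N by (auto intro!: bexI[of _ "\<phi> _ mod N"])
    qed
    also have "\<dots> = (\<Sum>j\<in>{0..<N}. card {g \<in> F n. \<phi> g mod N = j mod N})"
      by (rule card_UN_disjoint) (use fin[of n] in \<open>auto simp: mod_pos_pos_trivial\<close>)
    finally have "real (card (F n)) = (\<Sum>j\<in>{0..<N}. real (card {g \<in> F n. \<phi> g mod N = j mod N}))"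
      by simp
    then show ?thesis using cardpos[of n] by (simp add: c_def flip: sum_divide_distrib)
  qed
  have "(\<lambda>n. (1 - (\<Sum>j\<in>{0..<N}. c j n - c 0 n)) / real_of_int N) = c 0"
    using N sum1 by (simp add: fun_eq_iff sum_subtractf)
  moreover have "(\<lambda>n. (1 - (\<Sum>j\<in>{0..<N}. c j n - c 0 n)) / real_of_int N)
      \<longlonglongrightarrow> (1 - (\<Sum>j\<in>{0..<N}. 0)) / real_of_int N"
  proof (intro tendsto_intros)
    show "(\<lambda>n. c j n - c 0 n) \<longlonglongrightarrow> 0" if "j \<in> {0..<N}" for j
      using from0[of "nat j"] that by simp
    show "real_of_int N \<noteq> 0" using N by simp
  qed
  ultimately have c0: "c 0 \<longlonglongrightarrow> 1 / real_of_int N" by simp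
  have "(\<lambda>n. (c (int (nat (j mod N))) n - c 0 n) + c 0 n) \<longlonglongrightarrow> 0 + 1 / real_of_int N"
    by (intro tendsto_add from0 c0)
  moreover have "c (int (nat (j mod N))) = c j" using N by (simp add: c_def fun_eq_iff)
  ultimately have "c j \<longlonglongrightarrow> 1 / real_of_int N" by (simp only: diff_add_cancel add_0)
  then show ?thesis by (simp add: c_def[abs_def])
qed

lemma periodic_set_frequency:
  assumes F: "folner_sequence G F" and N: "N > 0" and P: "\<And>k. k mod N \<in> P \<longleftrightarrow> k \<in> P"
  shows "(\<lambda>n. real (card {g \<in> F n. \<phi> g + i \<in> P}) / real (card (F n)))
    \<longlonglongrightarrow> real (card (P \<inter> {0..<N})) / real_of_int N"
proof -
  have fin: "finite (F n)" for n using F by (simp add: folner_sequence_def)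
  have res: "\<phi> g mod N = (j - i) mod N \<longleftrightarrow> (\<phi> g + i) mod N = j" if "j \<in> {0..<N}" for g j
  proof -
    have "\<phi> g mod N = (j - i) mod N \<longleftrightarrow> (\<phi> g + i) mod N = j mod N"
      by (simp add: mod_eq_dvd_iff algebra_simps)
    then show ?thesis using that by simp
  qed
  have "real (card {g \<in> F n. \<phi> g + i \<in> P}) / real (card (F n)) =
    (\<Sum>j\<in>P \<inter> {0..<N}. real (card {g \<in> F n. \<phi> g mod N = (j - i) mod N}) / real (card (F n)))" for n
  proof -
    have "{g \<in> F n. \<phi> g + i \<in> P} = (\<Union>j\<in>P \<inter> {0..<N}. {g \<in> F n. \<phi> g mod N = (j - i) mod N})"
    proof (intro equalityI subsetI)
      fix g assume "g \<in> {g \<in> F n. \<phi> g + i \<in> P}"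
      then show "g \<in> (\<Union>j\<in>P \<inter> {0..<N}. {g \<in> F n. \<phi> g mod N = (j - i) mod N})"
        using N P by (intro UN_I[of "(\<phi> g + i) mod N"]) (auto simp: res)
    next
      fix g assume "g \<in> (\<Union>j\<in>P \<inter> {0..<N}. {g \<in> F n. \<phi> g mod N = (j - i) mod N})"
      then obtain j where j: "j \<in> P" "j \<in> {0..<N}" "g \<in> F n" "\<phi> g mod N = (j - i) mod N" by blast
      then have "(\<phi> g + i) mod N \<in> P" using res by simp
      then show "g \<in> {g \<in> F n. \<phi> g + i \<in> P}" using P j by simp
    qed
    moreover have "card (\<Union>j\<in>P \<inter> {0..<N}. {g \<in> F n. \<phi> g mod N = (j - i) mod N}) =
        (\<Sum>j\<in>P \<inter> {0..<N}. card {g \<in> F n. \<phi> g mod N = (j - i) mod N})"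
      by (rule card_UN_disjoint) (use fin[of n] res in auto)
    ultimately show ?thesis by (simp add: sum_divide_distrib)
  qed
  moreover have "(\<lambda>n. \<Sum>j\<in>P \<inter> {0..<N}.
      real (card {g \<in> F n. \<phi> g mod N = (j - i) mod N}) / real (card (F n)))
    \<longlonglongrightarrow> (\<Sum>j\<in>P \<inter> {0..<N}. 1 / real_of_int N)"
    by (intro tendsto_sum residue_frequency F N)
  ultimately show ?thesis by simp
qed

definition multiples :: "int \<Rightarrow> 'a set" where
  "multiples N = {g \<in> carrier G. N dvd \<phi> g}"

lemma multiples_subgroup: "subgroup (multiples N) G"
proof (rule subgroupI)
  show "multiples N \<noteq> {}" unfolding multiples_def using \<phi>_one by (auto intro!: exI[of _ \<one>])
qed (auto simp: multiples_def \<phi>_inv \<phi>_mult)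

lemma multiples_coset:
  assumes g: "g \<in> carrier G"
  shows "g <# multiples N = {h \<in> carrier G. \<phi> h mod N = \<phi> g mod N}"
proof (intro equalityI subsetI)
  fix h assume "h \<in> g <# multiples N"
  then show "h \<in> {h \<in> carrier G. \<phi> h mod N = \<phi> g mod N}"
    using g by (auto simp: l_coset_def multiples_def \<phi>_mult mod_eq_dvd_iff)
next
  fix h assume h: "h \<in> {h \<in> carrier G. \<phi> h mod N = \<phi> g mod N}"
  then have "inv g \<otimes> h \<in> multiples N"
    using g by (simp add: multiples_def \<phi>_mult \<phi>_inv mod_eq_dvd_iff)
  moreover have "h = g \<otimes> (inv g \<otimes> h)" using g h by (simp flip: m_assoc)
  ultimately show "h \<in> g <# multiples N" unfolding l_coset_def by blast
qed

lemma multiples_fundamental_domain: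
  assumes N: "N > 0"
  obtains D where "fundamental_domain G (multiples N) D" "bij_betw \<phi> D {0..<N}"
proof -
  obtain s where s: "\<And>k. s k \<in> carrier G" "\<And>k. \<phi> (s k) = k" using \<phi>_surj by metis
  have "bij_betw \<phi> (s ` {0..<N}) {0..<N}"
    by (rule bij_betwI[where g = s]) (use s in auto)
  moreover have "fundamental_domain G (multiples N) (s ` {0..<N})"
    unfolding fundamental_domain_def bij_betw_def
  proof (intro conjI)
    show "s ` {0..<N} \<subseteq> carrier G" using s by blast
    show "inj_on (\<lambda>g. g <# multiples N) (s ` {0..<N})"
    proof (rule inj_onI, elim imageE)
      fix g h j k assume *: "g <# multiples N = h <# multiples N" "g = s j" "h = s k"
        "j \<in> {0..<N}" "k \<in> {0..<N}"
      have "g \<in> h <# multiples N" unfolding *(1)[symmetric] using *(2) s by (simp add: multiples_coset)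
      then have "j mod N = k mod N" using * s by (simp add: multiples_coset)
      then show "g = h" using * by simp
    qed
    show "(\<lambda>g. g <# multiples N) ` s ` {0..<N} = lcosets multiples N"
    proof (intro equalityI subsetI)
      fix C assume "C \<in> lcosets multiples N"
      then obtain g where g: "g \<in> carrier G" "C = g <# multiples N" by (auto simp: LCOSETS_def)
      then have "C = s (\<phi> g mod N) <# multiples N" using s by (simp add: multiples_coset)
      then show "C \<in> (\<lambda>g. g <# multiples N) ` s ` {0..<N}" using N by auto
    qed (use s in \<open>auto simp: LCOSETS_def\<close>)
  qed
  ultimately show thesis using that by blast
qed

lemma multiples_finite_index: "N > 0 \<Longrightarrow> finite_index_subgroup G (multiples N)"
  using multiples_fundamental_domain[of N] multiples_subgroup
  unfolding finite_index_subgroup_def fundamental_domain_def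
  by (metis bij_betw_finite finite_atLeastLessThan_int)

end

lemma besicovitch_dist_le:
  assumes F: "folner_sequence G F"
    and Q: "\<And>g. g \<in> carrier G \<Longrightarrow> z g \<noteq> w g \<Longrightarrow> Q g"
    and lim: "(\<lambda>n. real (card {g \<in> F n. Q g}) / real (card (F n))) \<longlonglongrightarrow> r"
  shows "besicovitch_dist F z w \<le> r"
proof -
  have fin: "finite (F n)" and sub: "F n \<subseteq> carrier G" for n
    using F by (auto simp: folner_sequence_def)
  have "card {g \<in> F n. z g \<noteq> w g} \<le> card {g \<in> F n. Q g}" for n
    by (rule card_mono) (use fin sub Q in auto)
  then have "ereal (besicovitch_dist F z w) \<le>
    limsup (\<lambda>n. ereal (real (card {g \<in> F n. Q g}) / real (card (F n))))"
    unfolding besicovitch_limsup[OF fin] by (intro Limsup_mono always_eventually allI) (simp add: divide_right_mono)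
  also have "\<dots> = ereal r"
    by (rule lim_imp_Limsup) (use lim in simp_all)
  finally show ?thesis by simp
qed

lemma besicovitch_dist_ge:
  assumes F: "folner_sequence G F"
    and Q: "\<And>g. g \<in> carrier G \<Longrightarrow> Q g \<Longrightarrow> z g \<noteq> w g"
    and lim: "(\<lambda>n. real (card {g \<in> F n. Q g}) / real (card (F n))) \<longlonglongrightarrow> r"
  shows "r \<le> besicovitch_dist F z w"
proof -
  have fin: "finite (F n)" and sub: "F n \<subseteq> carrier G" for n
    using F by (auto simp: folner_sequence_def)
  have le: "card {g \<in> F n. Q g} \<le> card {g \<in> F n. z g \<noteq> w g}" for n
    by (rule card_mono) (use fin sub Q in auto)
  have "ereal r = limsup (\<lambda>n. ereal (real (card {g \<in> F n. Q g}) / real (card (F n))))"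
    by (rule lim_imp_Limsup[symmetric]) (use lim in simp_all)
  also have "\<dots> \<le> ereal (besicovitch_dist F z w)"
    unfolding besicovitch_limsup[OF fin]
    by (intro Limsup_mono always_eventually allI ereal_less_eq(3)[THEN iffD2] divide_right_mono
        of_nat_mono le) simp
  finally show ?thesis by simp
qed


section \<open>Separation numbers and box dimension\<close>

lemma separation_number_le:
  assumes "finite T" "f ` Z \<subseteq> T"
    and "\<And>p q. p \<in> Z \<Longrightarrow> q \<in> Z \<Longrightarrow> f p = f q \<Longrightarrow> d p q < \<epsilon>"
  shows "separation_number Z d \<epsilon> \<le> enat (card T)"
  unfolding separation_number_def
proof (rule SUP_least)
  fix S assume "S \<in> {S. S \<subseteq> Z \<and> pairwise (\<lambda>p q. \<epsilon> \<le> d p q) S}"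
  then have S: "S \<subseteq> Z" "pairwise (\<lambda>p q. \<epsilon> \<le> d p q) S" by auto
  have inj: "inj_on f S"
  proof (rule inj_onI, rule ccontr)
    fix p q assume "p \<in> S" "q \<in> S" "f p = f q" "p \<noteq> q"
    then show False using S assms(3)[of p q] pairwiseD[OF S(2), of p q] by fastforce
  qed
  have "f ` S \<subseteq> T" using S assms by auto
  then have "finite S" "card S \<le> card T"
    using inj_on_finite[OF inj _ assms(1)] card_inj_on_le[OF inj _ assms(1)] by auto
  then show "(if finite S then enat (card S) else \<infinity>) \<le> enat (card T)" by simp
qed

lemma separation_number_ge:
  assumes "finite T" "f ` T \<subseteq> Z" "inj_on f T"
    and "\<And>s t. s \<in> T \<Longrightarrow> t \<in> T \<Longrightarrow> s \<noteq> t \<Longrightarrow> \<epsilon> \<le> d (f s) (f t)"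
  shows "enat (card T) \<le> separation_number Z d \<epsilon>"
proof -
  have "pairwise (\<lambda>p q. \<epsilon> \<le> d p q) (f ` T)"
    using assms(4) by (auto simp: pairwise_def) 
  then have "(if finite (f ` T) then enat (card (f ` T)) else \<infinity>) \<le> separation_number Z d \<epsilon>"
    unfolding separation_number_def using assms(2) by (intro SUP_upper) simp
  then show ?thesis using assms by (simp add: card_image)
qed

lemma box_dimensions_eqI:
  assumes "\<delta> > 0" and sep: "\<And>\<epsilon>. 0 < \<epsilon> \<Longrightarrow> \<epsilon> < \<delta> \<Longrightarrow> \<exists>k. separation_number Z d \<epsilon> = enat k \<and>
      a * (- ln \<epsilon>) - C \<le> ln (real k) \<and> ln (real k) \<le> a * (- ln \<epsilon>) + C"
  shows "upper_box_dimension Z d = ereal a" "lower_box_dimension Z d = ereal a"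
proof -
  let ?f = "\<lambda>\<epsilon>. log_enat (separation_number Z d \<epsilon>) / ereal (- ln \<epsilon>)"
  have ev: "eventually (\<lambda>\<epsilon>. 0 < \<epsilon> \<and> \<epsilon> < min \<delta> 1) (at_right (0 :: real))"
    by (rule eventually_at_rightI[of 0 "min \<delta> 1"]) (use assms(1) in auto)
  have bounds: "eventually (\<lambda>\<epsilon>. ereal (a - C / (- ln \<epsilon>)) \<le> ?f \<epsilon> \<and> ?f \<epsilon> \<le> ereal (a + C / (- ln \<epsilon>)))
    (at_right 0)"
  proof (rule eventually_mono[OF ev], elim conjE)
    fix \<epsilon> :: real assume \<epsilon>: "0 < \<epsilon>" "\<epsilon> < min \<delta> 1"
    then obtain k where k: "separation_number Z d \<epsilon> = enat k"
      "a * (- ln \<epsilon>) - C \<le> ln (real k)" "ln (real k) \<le> a * (- ln \<epsilon>) + C"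
      using sep[of \<epsilon>] by auto
    have L: "- ln \<epsilon> > 0" using \<epsilon> by simp
    have "(a * (- ln \<epsilon>) - C) / (- ln \<epsilon>) \<le> ln (real k) / (- ln \<epsilon>)"
      "ln (real k) / (- ln \<epsilon>) \<le> (a * (- ln \<epsilon>) + C) / (- ln \<epsilon>)"
      using L k by (intro divide_right_mono; simp)+
    then have "a - C / (- ln \<epsilon>) \<le> ln (real k) / (- ln \<epsilon>)"
      "ln (real k) / (- ln \<epsilon>) \<le> a + C / (- ln \<epsilon>)"
      using L by (simp_all only: diff_divide_distrib add_divide_distrib) simp_all
    moreover have "?f \<epsilon> = ereal (ln (real k) / (- ln \<epsilon>))"
      using L by (simp add: k log_enat_def)
    ultimately show "ereal (a - C / (- ln \<epsilon>)) \<le> ?f \<epsilon> \<and> ?f \<epsilon> \<le> ereal (a + C / (- ln \<epsilon>))"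
      by simp
  qed
  have L: "filterlim (\<lambda>\<epsilon>. - ln \<epsilon> :: real) at_top (at_right 0)"
    using ln_at_0 by (simp add: filterlim_uminus_at_top)
  have C0: "((\<lambda>\<epsilon>. C / (- ln \<epsilon>)) \<longlongrightarrow> 0) (at_right (0 :: real))"
    by (rule tendsto_divide_0[OF tendsto_const]) (rule filterlim_mono[OF L at_top_le_at_infinity order_refl])
  have "(?f \<longlongrightarrow> ereal a) (at_right 0)"
  proof (rule tendsto_sandwich)
    show "((\<lambda>\<epsilon>. ereal (a - C / (- ln \<epsilon>))) \<longlongrightarrow> ereal a) (at_right 0)"
      using tendsto_diff[OF tendsto_const[of a] C0] by simp
    show "((\<lambda>\<epsilon>. ereal (a + C / (- ln \<epsilon>))) \<longlongrightarrow> ereal a) (at_right 0)"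
      using tendsto_add[OF tendsto_const[of a] C0] by simp
    show "eventually (\<lambda>\<epsilon>. ereal (a - C / (- ln \<epsilon>)) \<le> ?f \<epsilon>) (at_right 0)"
      using bounds by eventually_elim simp
    show "eventually (\<lambda>\<epsilon>. ?f \<epsilon> \<le> ereal (a + C / (- ln \<epsilon>))) (at_right 0)"
      using bounds by eventually_elim simp
  qed
  then show "upper_box_dimension Z d = ereal a" "lower_box_dimension Z d = ereal a"
    unfolding upper_box_dimension_def lower_box_dimension_def
    by (simp_all add: lim_imp_Limsup lim_imp_Liminf)
qed

text \<open>
  The scales \<open>q powr (- n / a)\<close> form a geometric progression, so every small \<open>\<epsilon>\<close> is within a constant
  factor of one of them.  The separation number is therefore \<open>\<epsilon> powr (- a)\<close> up to constant factors.
\<close>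
lemma box_dimensions_from_geometric_scales:
  fixes q :: nat and a c :: real
  assumes q: "q \<ge> 2" and a: "a > 0" and c: "0 < c" "c \<le> 1"
    and upper: "\<And>n \<epsilon>. q powr (- (n / a)) < \<epsilon> \<Longrightarrow> separation_number Z d \<epsilon> \<le> enat (q ^ n)"
    and lower: "\<And>n \<epsilon>. 0 < \<epsilon> \<Longrightarrow> \<epsilon> \<le> c * q powr (- (n / a)) \<Longrightarrow> enat (q ^ n) \<le> separation_number Z d \<epsilon>"
  shows "upper_box_dimension Z d = ereal a \<and> lower_box_dimension Z d = ereal a"
proof -
  define C where "C = ln q + a * (- ln c)"
  have lq: "ln (real q) > 0" using q by simp
  have lc: "a * (- ln c) \<ge> 0" using c a by (simp add: mult_nonneg_nonpos)
  have sep: "\<exists>k. separation_number Z d \<epsilon> = enat k \<and>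
      a * (- ln \<epsilon>) - C \<le> ln (real k) \<and> ln (real k) \<le> a * (- ln \<epsilon>) + C"
    if \<epsilon>: "0 < \<epsilon>" "\<epsilon> < c" for \<epsilon>
  proof -
    have \<epsilon>1: "ln \<epsilon> < 0" "ln \<epsilon> < ln c" using \<epsilon> c by simp_all
    \<comment> \<open>The least \<open>m\<close> to which the upper bound applies.\<close>
    define m where "m = nat \<lfloor>a * (- ln \<epsilon>) / ln q\<rfloor> + 1"
    have "a * (- ln \<epsilon>) / ln q \<ge> 0" using a lq \<epsilon>1 by (simp add: divide_nonpos_pos mult_nonneg_nonpos)
    then have m: "a * (- ln \<epsilon>) / ln q < real m" "real m \<le> a * (- ln \<epsilon>) / ln q + 1"
      unfolding m_def by linarith+
    have mlq: "a * (- ln \<epsilon>) < m * ln q" "m * ln q \<le> a * (- ln \<epsilon>) + ln q"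
      using m lq by (simp_all add: field_simps)
    have "q powr (- (m / a)) < \<epsilon>"
    proof -
      have "- (m / a) * ln q < ln \<epsilon>" using mlq(1) a by (simp add: field_simps)
      then have "exp (- (m / a) * ln q) < exp (ln \<epsilon>)" by simp
      then show ?thesis using q \<epsilon> by (simp add: powr_def)
    qed
    then have up: "separation_number Z d \<epsilon> \<le> enat (q ^ m)" by (rule upper)
    then obtain k where k: "separation_number Z d \<epsilon> = enat k" by (cases "separation_number Z d \<epsilon>") auto
    \<comment> \<open>The largest \<open>l\<close> to which the lower bound applies.\<close>
    define l where "l = nat \<lfloor>a * (ln c - ln \<epsilon>) / ln q\<rfloor>"
    have "a * (ln c - ln \<epsilon>) / ln q \<ge> 0" using a lq \<epsilon>1 by simp
    then have l: "real l \<le> a * (ln c - ln \<epsilon>) / ln q" "a * (ln c - ln \<epsilon>) / ln q - 1 \<le> real l"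
      unfolding l_def by linarith+
    have llq: "l * ln q \<le> a * (ln c - ln \<epsilon>)" "a * (ln c - ln \<epsilon>) - ln q \<le> l * ln q"
      using l lq by (simp_all add: field_simps)
    have "\<epsilon> \<le> c * q powr (- (l / a))"
    proof -
      have "ln \<epsilon> \<le> ln c + - (l / a) * ln q" using llq(1) a by (simp add: field_simps)
      then have "exp (ln \<epsilon>) \<le> exp (ln c + - (l / a) * ln q)" by simp
      then show ?thesis using q c \<epsilon> by (simp add: powr_def exp_diff exp_minus field_simps)
    qed
    then have lo: "enat (q ^ l) \<le> separation_number Z d \<epsilon>" by (rule lower[OF \<epsilon>(1)])
    have kq: "real (q ^ l) \<le> real k" "real k \<le> real (q ^ m)" using lo up unfolding k by simp_all
    have pos: "0 < real (q ^ l)" using q by simp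
    then have kpos: "0 < real k" using kq by linarith
    have "ln (real (q ^ l)) \<le> ln (real k)" "ln (real k) \<le> ln (real (q ^ m))"
      by (rule ln_mono[OF kq(1) pos], rule ln_mono[OF kq(2) kpos])
    then have "l * ln q \<le> ln (real k)" "ln (real k) \<le> m * ln q"
      using q by (simp_all add: ln_realpow)
    then show ?thesis using k mlq llq lq lc by (intro exI[of _ k]) (simp add: C_def algebra_simps)
  qed
  from box_dimensions_eqI[OF c(1) sep] show ?thesis by simp
qed


section \<open>The pulled back Toeplitz array\<close>

locale toeplitz_pullback = int_quotient G \<phi> + hole_digits q u
  for G :: "('a, 'b) monoid_scheme" (structure) and \<phi> :: "'a \<Rightarrow> int" and q :: int and u :: "nat \<Rightarrow> int"
begin

definition pullback :: "'a \<Rightarrow> bool" where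
  "pullback = (\<lambda>g\<in>carrier G. y (\<phi> g))"

definition hole_density :: "nat \<Rightarrow> real" where
  "hole_density n = (\<Prod>i<n. real_of_int (u i)) / real_of_int q ^ n"

lemma hole_density_pos: "hole_density n > 0"
proof -
  have "real_of_int (u i) > 0" for i using u_ge_1[of i] by simp
  then show ?thesis using q_ge_3 by (auto simp: hole_density_def intro!: prod_pos divide_pos_pos)
qed

lemma hole_density_antimono: "m \<le> n \<Longrightarrow> hole_density n \<le> hole_density m"
proof (induction n rule: dec_induct)
  case (step n)
  have "hole_density (Suc n) = hole_density n * (u n / q)"
    by (simp add: hole_density_def)
  also have "\<dots> \<le> hole_density n * 1"
    using u_ge_1[of n] two_u[of n] q_ge_3 hole_density_pos[of n] by (intro mult_left_mono) auto
  finally show ?case using step by simp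
qed simp

lemma prod_u: "real (nat (\<Prod>i<n. u i)) = (\<Prod>i<n. real_of_int (u i))"
proof -
  have "(\<Prod>i<n. u i) \<ge> 0" using u_ge_1 order_trans[OF zero_le_one] by (intro prod_nonneg) auto
  then show ?thesis by (simp add: of_int_prod)
qed

lemma hole_frequency:
  assumes "folner_sequence G F"
  shows "(\<lambda>n. real (card {g \<in> F n. \<phi> g + i \<in> H m}) / real (card (F n))) \<longlonglongrightarrow> hole_density m"
proof -
  have "(\<lambda>n. real (card {g \<in> F n. \<phi> g + i \<in> H m}) / real (card (F n)))
    \<longlonglongrightarrow> real (card (H m \<inter> {0..<q ^ m})) / real_of_int (q ^ m)"
  proof (rule periodic_set_frequency[OF assms])
    show "k mod q ^ m \<in> H m \<longleftrightarrow> k \<in> H m" for k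
      using holes_periodic[of "k mod q ^ m" m "k div q ^ m"] by simp
  qed (use q_ge_3 in simp)
  then show ?thesis by (simp add: card_holes prod_u hole_density_def)
qed

lemma first_hole_frequency:
  assumes "folner_sequence G F"
  shows "(\<lambda>n. real (card {g \<in> F n. \<phi> g + i \<in> first_holes m}) / real (card (F n)))
    \<longlonglongrightarrow> hole_density m / q"
proof -
  have "(\<lambda>n. real (card {g \<in> F n. \<phi> g + i \<in> first_holes m}) / real (card (F n)))
    \<longlonglongrightarrow> real (card (first_holes m \<inter> {0..<q ^ Suc m})) / real_of_int (q ^ Suc m)"
  proof (rule periodic_set_frequency[OF assms])
    show "k mod q ^ Suc m \<in> first_holes m \<longleftrightarrow> k \<in> first_holes m" for k
      using first_holes_periodic[of "k mod q ^ Suc m" m "k div q ^ Suc m"] by simp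
  qed (use q_ge_3 in simp)
  then show ?thesis
    unfolding card_first_holes prod_u by (simp add: hole_density_def mult.commute)
qed

lemma pullback_array: "pullback \<in> arrays G"
  by (simp add: pullback_def arrays_def)

lemma shift_pullback:
  "g \<in> carrier G \<Longrightarrow> h \<in> carrier G \<Longrightarrow> shift G g pullback h = y (\<phi> h + \<phi> g)"
  by (simp add: shift_def pullback_def \<phi>_mult)

lemma Per_multiples:
  assumes "g \<in> carrier G" "\<phi> g \<notin> H n"
  shows "g \<in> Per G pullback (multiples (q ^ n))"
proof -
  have "pullback (g \<otimes> h) = pullback g" if "h \<in> multiples (q ^ n)" for h
  proof -
    have h: "h \<in> carrier G" "q ^ n dvd \<phi> h" using that by (auto simp: multiples_def)
    from h(2) obtain c where "\<phi> h = q ^ n * c" by (rule dvdE)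
    then show ?thesis
      using assms h(1) by (simp add: pullback_def \<phi>_mult hole_sequence_periodic)
  qed
  then show ?thesis using assms by (cases "pullback g") (auto simp: Per_def Per_symbol_def)
qed

lemma toeplitz_pullback: "toeplitz_array G pullback"
proof -
  have "\<exists>\<Gamma>. finite_index_subgroup G \<Gamma> \<and> g \<in> Per G pullback \<Gamma>" if "g \<in> carrier G" for g
  proof -
    obtain n where "\<phi> g \<notin> H n" using eventually_not_hole by blast
    then show ?thesis
      using that Per_multiples multiples_finite_index[of "q ^ n"] q_ge_3
      by (intro exI[of _ "multiples (q ^ n)"]) simp
  qed
  then show ?thesis by (simp add: toeplitz_array_def pullback_array)
qed

lemma periodic_density_ge:
  "1 - hole_density n \<le> periodic_density G pullback (multiples (q ^ n))"
proof -
  have qn: "q ^ n > 0" using q_ge_3 by simp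
  obtain D where D: "fundamental_domain G (multiples (q ^ n)) D" "bij_betw \<phi> D {0..<q ^ n}"
    using multiples_fundamental_domain[OF qn] by blast
  have Dc: "D \<subseteq> carrier G" using D(1) by (simp add: fundamental_domain_def)
  have finD: "finite D" using bij_betw_finite[OF D(2)] by simp
  have cardD: "card D = nat (q ^ n)" using bij_betw_same_card[OF D(2)] by simp
  let ?P = "Per G pullback (multiples (q ^ n))"
  have "card (D - ?P) \<le> card (H n \<inter> {0..<q ^ n})"
  proof (rule card_inj_on_le[of \<phi>])
    show "inj_on \<phi> (D - ?P)" using D(2) by (auto simp: bij_betw_def intro: inj_on_subset)
    show "\<phi> ` (D - ?P) \<subseteq> H n \<inter> {0..<q ^ n}"
      using D(2) Dc Per_multiples by (auto simp: bij_betw_def)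
  qed simp
  moreover have "card D = card (D \<inter> ?P) + card (D - ?P)"
    using card_Int_Diff[OF finD] .
  ultimately have "real (card D) - real (nat (\<Prod>i<n. u i)) \<le> real (card (D \<inter> ?P))"
    by (simp add: card_holes)
  moreover have "real (card D) = real_of_int q ^ n" using qn by (simp add: cardD)
  ultimately have "(real_of_int q ^ n - (\<Prod>i<n. real_of_int (u i))) / real_of_int q ^ n
      \<le> real (card (D \<inter> ?P)) / real (card D)"
    using qn by (simp add: prod_u divide_right_mono)
  moreover have "(real_of_int q ^ n - (\<Prod>i<n. real_of_int (u i))) / real_of_int q ^ n = 1 - hole_density n"
    using q_ge_3 by (simp add: hole_density_def diff_divide_distrib)
  ultimately show ?thesis
    by (simp add: periodic_density_eq[OF is_group multiples_subgroup D(1)])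
qed

text \<open>
  The subgroup \<open>multiples (q ^ n)\<close> already has density at least \<open>1 - hole_density n\<close>.
\<close>
lemma regular_pullback:
  assumes "hole_density \<longlonglongrightarrow> 0"
  shows "regular_toeplitz_array G pullback"
proof -
  let ?I = "{\<Gamma>. finite_index_subgroup G \<Gamma>}"
  let ?d = "periodic_density G pullback"
  have le1: "?d \<Gamma> \<le> 1" if "\<Gamma> \<in> ?I" for \<Gamma>
  proof -
    obtain D where D: "fundamental_domain G \<Gamma> D" using fundamental_domain_exists by blast
    have sub: "subgroup \<Gamma> G" "finite (lcosets \<Gamma>)" using that by (auto simp: finite_index_subgroup_def)
    have "finite D" using D sub(2) bij_betw_finite unfolding fundamental_domain_def by blast
    then have "card (D \<inter> Per G pullback \<Gamma>) \<le> card D" by (intro card_mono) auto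
    then show ?thesis
      by (cases "card D = 0") (simp_all add: periodic_density_eq[OF is_group sub(1) D])
  qed
  have memI: "multiples (q ^ n) \<in> ?I" for n
    using multiples_finite_index q_ge_3 by simp
  have "(SUP \<Gamma>\<in>?I. ?d \<Gamma>) \<le> 1" using memI le1 by (intro cSUP_least) auto
  moreover have "1 \<le> (SUP \<Gamma>\<in>?I. ?d \<Gamma>)"
  proof (rule LIMSEQ_le_const2)
    show "(\<lambda>n. 1 - hole_density n) \<longlonglongrightarrow> 1" using tendsto_diff[OF tendsto_const assms, of 1] by simp
    have "?d (multiples (q ^ n)) \<le> (SUP \<Gamma>\<in>?I. ?d \<Gamma>)" for n
      by (rule cSUP_upper[OF memI]) (use le1 in \<open>auto intro!: bdd_aboveI2\<close>)
    then show "\<exists>N. \<forall>n\<ge>N. 1 - hole_density n \<le> (SUP \<Gamma>\<in>?I. ?d \<Gamma>)"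
      using periodic_density_ge order_trans by blast
  qed
  ultimately show ?thesis using toeplitz_pullback by (simp add: regular_toeplitz_array_def)
qed

text \<open>
  A shift of the array by \<open>g\<close> depends, off the holes, only on the residue of \<open>\<phi> g\<close> modulo
  \<open>q ^ n\<close>.  For each of the finitely many residues \<open>i\<close>, agreeing with the sequence translated by
  \<open>i\<close> off the holes is a closed condition, so it passes to the orbit closure.
\<close>
lemma orbit_closure_skeleton:
  assumes "z \<in> orbit_closure G pullback"
  shows "\<exists>i\<in>{0..<q ^ n}. \<forall>h\<in>carrier G. \<phi> h + i \<notin> H n \<longrightarrow> z h = y (\<phi> h + i)"
proof -
  let ?T = "array_topology G"
  define C where "C i = {z \<in> topspace ?T. \<forall>h\<in>carrier G. \<phi> h + i \<notin> H n \<longrightarrow> z h = y (\<phi> h + i)}" for i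
  have closed: "closedin ?T (C i)" for i
  proof -
    have "closedin ?T {z \<in> topspace ?T. z h \<in> {y (\<phi> h + i)}}" if "h \<in> carrier G" for h
    proof (rule closedin_continuous_map_preimage)
      show "continuous_map ?T (discrete_topology UNIV) (\<lambda>z. z h)"
        unfolding array_topology_def using that by (rule continuous_map_product_projection)
    qed simp
    then have "closedin ?T (\<Inter>(insert (topspace ?T) ((\<lambda>h. {z \<in> topspace ?T. z h \<in> {y (\<phi> h + i)}}) `
        {h \<in> carrier G. \<phi> h + i \<notin> H n})))"
      by (intro closedin_Inter) auto
    moreover have "\<Inter>(insert (topspace ?T) ((\<lambda>h. {z \<in> topspace ?T. z h \<in> {y (\<phi> h + i)}}) `
        {h \<in> carrier G. \<phi> h + i \<notin> H n})) = C i"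
      by (auto simp: C_def)
    ultimately show ?thesis by simp
  qed
  have qn: "q ^ n > 0" using q_ge_3 by simp
  have "shift_orbit G pullback \<subseteq> (\<Union>i\<in>{0..<q ^ n}. C i)"
  proof
    fix z assume "z \<in> shift_orbit G pullback"
    then obtain g where g: "g \<in> carrier G" "z = shift G g pullback" by (auto simp: shift_orbit_def)
    let ?i = "\<phi> g mod q ^ n"
    have "z h = y (\<phi> h + ?i)" if "h \<in> carrier G" "\<phi> h + ?i \<notin> H n" for h
    proof -
      have "\<phi> h + \<phi> g = (\<phi> h + ?i) + q ^ n * (\<phi> g div q ^ n)" by simp
      then show ?thesis
        using g that hole_sequence_periodic[OF that(2)] by (simp only: shift_pullback)
    qed
    moreover have "z \<in> topspace ?T"
      using g by (simp add: topspace_array_topology arrays_def shift_def)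
    ultimately have "z \<in> C ?i" by (simp add: C_def)
    then show "z \<in> (\<Union>i\<in>{0..<q ^ n}. C i)" using qn by auto
  qed
  moreover have "closedin ?T (\<Union>i\<in>{0..<q ^ n}. C i)"
    using closed by (intro closedin_Union) auto
  ultimately have "orbit_closure G pullback \<subseteq> (\<Union>i\<in>{0..<q ^ n}. C i)"
    unfolding orbit_closure_def by (rule closure_of_minimal)
  then show ?thesis using assms by (auto simp: C_def)
qed

lemma orbit_closure_arrays: "orbit_closure G pullback \<subseteq> arrays G"
  unfolding orbit_closure_def topspace_array_topology[symmetric] by (rule closure_of_subset_topspace)

lemma shift_in_orbit_closure:
  assumes "g \<in> carrier G"
  shows "shift G g pullback \<in> orbit_closure G pullback"
proof -
  have "shift_orbit G pullback \<subseteq> topspace (array_topology G)"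
    by (auto simp: shift_orbit_def topspace_array_topology arrays_def shift_def)
  then show ?thesis
    using closure_of_subset assms unfolding orbit_closure_def shift_orbit_def by blast
qed

text \<open>
  Two points of the orbit closure with the same residue differ at most at the holes of level \<open>n\<close>.
\<close>
lemma separation_number_upper:
  assumes F: "folner_sequence G F" and \<epsilon>: "hole_density n < \<epsilon>"
  shows "separation_number (besicovitch_image G F (orbit_closure G pullback)) (class_dist F) \<epsilon>
    \<le> enat (nat (q ^ n))"
proof -
  let ?X = "orbit_closure G pullback"
  let ?Z = "besicovitch_image G F ?X"
  have "\<forall>p\<in>?Z. \<exists>z. z \<in> ?X \<and> p = besicovitch_rel G F `` {z}"
    by (auto simp: besicovitch_image_def quotient_def)
  then obtain rep where rep: "\<And>p. p \<in> ?Z \<Longrightarrow> rep p \<in> ?X"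
    "\<And>p. p \<in> ?Z \<Longrightarrow> p = besicovitch_rel G F `` {rep p}" by metis
  obtain s where s: "\<And>z. z \<in> ?X \<Longrightarrow> s z \<in> {0..<q ^ n}"
    "\<And>z h. z \<in> ?X \<Longrightarrow> h \<in> carrier G \<Longrightarrow> \<phi> h + s z \<notin> H n \<Longrightarrow> z h = y (\<phi> h + s z)"
  proof -
    have "\<forall>z\<in>?X. \<exists>i. i \<in> {0..<q ^ n} \<and> (\<forall>h\<in>carrier G. \<phi> h + i \<notin> H n \<longrightarrow> z h = y (\<phi> h + i))"
      using orbit_closure_skeleton[of _ n] by blast
    from bchoice[OF this] show thesis using that by blast
  qed
  have "class_dist F p p' < \<epsilon>" if p: "p \<in> ?Z" "p' \<in> ?Z" "s (rep p) = s (rep p')" for p p'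
  proof -
    have "class_dist F p p' = besicovitch_dist F (rep p) (rep p')"
      using class_dist_eq[OF F] rep p orbit_closure_arrays by (metis subsetD)
    also have "\<dots> \<le> hole_density n"
    proof (rule besicovitch_dist_le[OF F _ hole_frequency[OF F]])
      fix g assume g: "g \<in> carrier G" "rep p g \<noteq> rep p' g"
      show "\<phi> g + s (rep p) \<in> H n"
        using g s(2)[OF rep(1)[OF p(1)] g(1)] s(2)[OF rep(1)[OF p(2)] g(1)] p(3) by auto
    qed
    finally show ?thesis using \<epsilon> by simp
  qed
  moreover have "(\<lambda>p. s (rep p)) ` ?Z \<subseteq> {0..<q ^ n}" using s(1) rep(1) by blast
  ultimately have "separation_number ?Z (class_dist F) \<epsilon> \<le> enat (card {0..<q ^ n})"
    by (intro separation_number_le[where f = "\<lambda>p. s (rep p)"]) auto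
  then show ?thesis by simp
qed

text \<open>
  Shifts with different residues modulo \<open>q ^ n\<close> differ on all first holes of some level \<open>v < n\<close>,
  hence with frequency at least \<open>hole_density v / q\<close>.
\<close>
lemma separation_number_lower:
  assumes F: "folner_sequence G F" and \<epsilon>: "0 < \<epsilon>" "\<epsilon> \<le> hole_density n / q"
  shows "enat (nat (q ^ n))
    \<le> separation_number (besicovitch_image G F (orbit_closure G pullback)) (class_dist F) \<epsilon>"
proof -
  let ?X = "orbit_closure G pullback"
  obtain t where t: "\<And>k. t k \<in> carrier G" "\<And>k. \<phi> (t k) = k" using \<phi>_surj by metis
  define z where "z k = shift G (t k) pullback" for k
  define c where "c k = besicovitch_rel G F `` {z k}" for k
  have zX: "z k \<in> ?X" for k using shift_in_orbit_closure t by (simp add: z_def)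
  have zv: "z k h = y (\<phi> h + k)" if "h \<in> carrier G" for k h
    using that t by (simp add: z_def shift_pullback)
  have dist: "\<epsilon> \<le> class_dist F (c i) (c j)" if ij: "i \<in> {0..<q ^ n}" "j \<in> {0..<q ^ n}" "i \<noteq> j" for i j
  proof -
    have "\<not> q ^ n dvd i - j"
      using ij by (auto simp flip: mod_eq_dvd_iff)
    then obtain v where v: "v < n"
      "(\<forall>k. k + i \<in> first_holes v \<longrightarrow> y (k + i) \<noteq> y (k + j)) \<or>
       (\<forall>k. k + j \<in> first_holes v \<longrightarrow> y (k + i) \<noteq> y (k + j))"
      by (rule separation_of_translates)
    from v(2) have "hole_density v / q \<le> besicovitch_dist F (z i) (z j)"
    proof
      assume "\<forall>k. k + i \<in> first_holes v \<longrightarrow> y (k + i) \<noteq> y (k + j)"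
      then show ?thesis
        by (intro besicovitch_dist_ge[OF F _ first_hole_frequency[OF F, of i]]) (simp add: zv)
    next
      assume "\<forall>k. k + j \<in> first_holes v \<longrightarrow> y (k + i) \<noteq> y (k + j)"
      then show ?thesis
        by (intro besicovitch_dist_ge[OF F _ first_hole_frequency[OF F, of j]]) (simp add: zv)
    qed
    moreover have "hole_density n / q \<le> hole_density v / q"
      using hole_density_antimono[of v n] v(1) q_ge_3 by (simp add: divide_right_mono)
    moreover have "class_dist F (c i) (c j) = besicovitch_dist F (z i) (z j)"
      unfolding c_def by (rule class_dist_eq[OF F]) (use zX orbit_closure_arrays in auto)
    ultimately show ?thesis using \<epsilon>(2) by simp
  qed
  have inj: "inj_on c {0..<q ^ n}"
  proof (rule inj_onI, rule ccontr)
    fix i j assume ij: "i \<in> {0..<q ^ n}" "j \<in> {0..<q ^ n}" "c i = c j" "i \<noteq> j"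
    have "class_dist F (c i) (c i) = 0"
      unfolding c_def using class_dist_eq[OF F, of "z i" "z i"] zX orbit_closure_arrays
      by (auto simp: besicovitch_dist_refl)
    then show False using dist[OF ij(1,2,4)] ij(3) \<epsilon>(1) by simp
  qed
  have "c ` {0..<q ^ n} \<subseteq> besicovitch_image G F ?X"
    using zX by (auto simp: c_def besicovitch_image_def intro: quotientI)
  then have "enat (card {0..<q ^ n}) \<le> separation_number (besicovitch_image G F ?X) (class_dist F) \<epsilon>"
    by (intro separation_number_ge[OF _ _ inj] dist) auto
  then show ?thesis by simp
qed

end


section \<open>Choice of the hole digits\<close>

text \<open>
  With \<open>q = 2 ^ b\<close>, the hole density of level \<open>n\<close> is to be about \<open>q powr (- n / a)\<close>, so the
  product of the first \<open>n\<close> values \<open>u i\<close> is to be about \<open>2 powr ((b - b / a) * n)\<close>.  Rounding the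
  exponent of the whole product, not those of its factors, keeps the error within a factor 2
  for all \<open>n\<close>; \<open>u i\<close> is then the quotient of consecutive products.
\<close>

definition hole_exponent :: "real \<Rightarrow> nat \<Rightarrow> nat \<Rightarrow> nat" where
  "hole_exponent a b n = nat \<lfloor>(b - b / a) * n\<rfloor>"

text \<open>
  The exponent grows by at most \<open>b - b / a\<close>, rounded up.  As \<open>b / a\<close> is at least 3, at least two
  of the \<open>b\<close> binary places of a digit remain, and \<open>u i\<close> is at most \<open>q / 4\<close>.
\<close>
lemma hole_exponent_step:
  assumes a: "1 \<le> a" and b: "3 * a \<le> b"
  shows "hole_exponent a b n \<le> hole_exponent a b (Suc n)"
    "hole_exponent a b (Suc n) - hole_exponent a b n \<le> b - 2"
proof -
  have b3: "real b / a \<ge> 3" using a b by (simp add: field_simps)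
  have "real b / a \<le> b" using a mult_right_mono[OF a, of b] by (simp add: field_simps)
  then have nn: "0 \<le> (b - b / a) * real k" for k :: nat by simp
  have le: "(b - b / a) * n \<le> (b - b / a) * Suc n"
    using \<open>real b / a \<le> b\<close> by (intro mult_left_mono) auto
  show mono: "hole_exponent a b n \<le> hole_exponent a b (Suc n)"
    unfolding hole_exponent_def by (intro nat_mono floor_mono le)
  have "(b - b / a) * Suc n \<le> (b - b / a) * n + (real b - 3)"
    using b3 by (simp add: algebra_simps add_divide_distrib)
  then have "\<lfloor>(b - b / a) * Suc n\<rfloor> \<le> \<lfloor>(b - b / a) * n\<rfloor> + (int b - 2)"
    by linarith
  moreover have "int (hole_exponent a b k) = \<lfloor>(b - b / a) * k\<rfloor>" for k
    using nn[of k] unfolding hole_exponent_def by simp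
  ultimately have "int (hole_exponent a b (Suc n)) \<le> int (hole_exponent a b n) + (int b - 2)"
    by simp
  moreover have "real b \<ge> 3" using a b by linarith
  ultimately show "hole_exponent a b (Suc n) - hole_exponent a b n \<le> b - 2" by linarith
qed

lemma hole_exponent_bounds:
  assumes "1 \<le> a"
  shows "hole_exponent a b n \<le> (b - b / a) * n" "(b - b / a) * n - 1 \<le> hole_exponent a b n"
proof -
  have "real b / a \<le> b" using assms mult_right_mono[OF assms, of b] by (simp add: field_simps)
  then have "0 \<le> (b - b / a) * real n" by simp
  then show "hole_exponent a b n \<le> (b - b / a) * n" "(b - b / a) * n - 1 \<le> hole_exponent a b n"
    unfolding hole_exponent_def by linarith+
qed

theorem theorem1p2:
  fixes G :: "('a, 'b) monoid_scheme" and a :: real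
  assumes "group G" and "infinite (carrier G)" and "finitely_generated_group G"
    and "torsion_free_group G" and "nilpotent_group G"
    and "1 \<le> a"
  shows "\<exists>x. regular_toeplitz_array G x \<and>
    (\<forall>F. folner_sequence G F \<longrightarrow> has_amorphic_complexity F (orbit_closure G x) G (ereal a))"
proof -
  interpret group G by fact
  have "carrier G \<noteq> {\<one>\<^bsub>G\<^esub>}" using assms(2) by auto
  then obtain \<phi> :: "'a \<Rightarrow> int" where
    \<phi>: "\<And>x y. x \<in> carrier G \<Longrightarrow> y \<in> carrier G \<Longrightarrow> \<phi> (x \<otimes>\<^bsub>G\<^esub> y) = \<phi> x + \<phi> y" "\<exists>t\<in>carrier G. \<phi> t = 1"
    using torsion_free_nilpotent_onto_int assms(3-5) by metis
  obtain b :: nat where b: "3 * a \<le> b" using real_arch_simple by blast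
  then have b3: "b \<ge> 3" using \<open>1 \<le> a\<close> by linarith
  let ?s = "hole_exponent a b"
  define u :: "nat \<Rightarrow> int" where "u i = 2 ^ (?s (Suc i) - ?s i)" for i
  define q :: int where "q = 2 ^ b"
  have two_u: "2 * u i < q" for i
  proof -
    have "2 * u i \<le> 2 * 2 ^ (b - 2)"
      unfolding u_def using hole_exponent_step(2)[OF \<open>1 \<le> a\<close> b] by simp
    also have "\<dots> = (2 :: int) ^ (b - 1)" using b3 by (simp flip: power_Suc add: Suc_diff_Suc numeral_2_eq_2)
    also have "\<dots> < q" unfolding q_def using b3 by (intro power_strict_increasing) auto
    finally show ?thesis .
  qed
  interpret toeplitz_pullback G \<phi> q u
    by unfold_locales (use \<phi> two_u in \<open>auto simp: u_def\<close>)
  have prod: "(\<Prod>i<n. real_of_int (u i)) = 2 ^ ?s n" for n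
  proof (induction n)
    case 0
    then show ?case by (simp add: hole_exponent_def)
  next
    case (Suc n)
    then show ?case
      using hole_exponent_step(1)[OF \<open>1 \<le> a\<close> b, of n] by (simp add: u_def flip: power_add)
  qed
  have q_powr: "real_of_int q powr x = 2 powr (b * x)" for x :: real
    by (simp add: q_def powr_powr flip: powr_realpow)
  have dens: "hole_density n = 2 powr (real (?s n) - b * n)" for n
    unfolding hole_density_def prod
    by (simp add: q_def powr_diff powr_realpow flip: power_mult)
       (simp add: powr_realpow flip: of_nat_mult)
  have dens_le: "hole_density n \<le> q powr (- (n / a))" for n
    unfolding dens q_powr using hole_exponent_bounds(1)[OF \<open>1 \<le> a\<close>, of b n]
    by (intro powr_mono) (simp_all add: algebra_simps)
  have dens_ge: "q powr (- (n / a)) / 2 \<le> hole_density n" for n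
  proof -
    have "q powr (- (n / a)) / 2 = 2 powr (b * (- (n / a)) - 1)"
      by (simp add: q_powr powr_diff)
    also have "\<dots> \<le> hole_density n"
      unfolding dens using hole_exponent_bounds(2)[OF \<open>1 \<le> a\<close>, of b n]
      by (intro powr_mono) (simp_all add: algebra_simps)
    finally show ?thesis .
  qed
  have dens0: "hole_density \<longlonglongrightarrow> 0"
  proof (rule tendsto_sandwich[OF always_eventually always_eventually tendsto_const])
    show "\<forall>n. 0 \<le> hole_density n" using hole_density_pos less_imp_le by blast
    have "q powr (- (n / a)) = (q powr (- (1 / a))) ^ n" for n :: nat
      using q_ge_3 by (simp add: powr_powr flip: powr_realpow)
    then show "\<forall>n. hole_density n \<le> (q powr (- (1 / a))) ^ n" using dens_le by metis
    have "q powr (- (1 / a)) < 1"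
      using q_ge_3 \<open>1 \<le> a\<close> by (simp add: powr_less_one)
    then show "(\<lambda>n. (q powr (- (1 / a))) ^ n) \<longlonglongrightarrow> 0" by (intro LIMSEQ_power_zero) simp
  qed
  have "has_amorphic_complexity F (orbit_closure G pullback) G (ereal a)"
    if F: "folner_sequence G F" for F
  proof -
    let ?sep = "separation_number (besicovitch_image G F (orbit_closure G pullback)) (class_dist F)"
    define k :: nat where "k = 2 ^ b"
    have nq: "real_of_int q = real k" "nat (q ^ n) = k ^ n" for n
      by (simp_all add: q_def k_def nat_power_eq)
    have upper: "?sep \<epsilon> \<le> enat (k ^ n)" if "k powr (- (n / a)) < \<epsilon>" for n \<epsilon>
      using separation_number_upper[OF F le_less_trans[OF dens_le[unfolded nq] that]] by (simp only: nq)
    have lower: "enat (k ^ n) \<le> ?sep \<epsilon>"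
      if "0 < \<epsilon>" "\<epsilon> \<le> 1 / (2 * real k) * k powr (- (n / a))" for n \<epsilon>
    proof -
      have "\<epsilon> \<le> (k powr (- (n / a)) / 2) / k" using that(2) by (simp add: mult.commute)
      also have "\<dots> \<le> hole_density n / q"
        unfolding nq by (intro divide_right_mono dens_ge[unfolded nq]) simp
      finally show ?thesis using separation_number_lower[OF F that(1), of n] by (simp only: nq)
    qed
    have "upper_box_dimension (besicovitch_image G F (orbit_closure G pullback)) (class_dist F) = ereal a \<and>
      lower_box_dimension (besicovitch_image G F (orbit_closure G pullback)) (class_dist F) = ereal a"
    proof (rule box_dimensions_from_geometric_scales[where q = k and c = "1 / (2 * real k)", OF _ _ _ _ upper lower])
      show "2 \<le> k" unfolding k_def using b3 self_le_power[of "2 :: nat" b] by simp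
      then show "0 < 1 / (2 * real k)" "1 / (2 * real k) \<le> 1" by simp_all
    qed (use \<open>1 \<le> a\<close> in auto)
    then show ?thesis
      by (simp add: has_amorphic_complexity_def upper_amorphic_complexity_def lower_amorphic_complexity_def)
  qed
  then show ?thesis using regular_pullback[OF dens0] by blast
qed

end
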